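(* Let $t\ge 1$ be a constant, and let $\mathcal{H}$ be a hereditary class of digraphs such that every (nonempty) sourceless digraph $D\in\mathcal{H}$ has a vertex $v\in V(D)$ satisfying one of the following: either $v\notin N^+(S(v))$ and $$t\,|N^+(v)\cup N^+(S(v))|\ \ge\ |S(v)|+1,$$ or $v\in N^+(S(v))$ and $$t\,|N^+(v)\cup N^+(S(v))|\ \ge\ |S(v)|.$$ Then there is an $O(n^4)$ time algorithm which takes any sourceless digraph $D\in\mathcal{H}$ of order $n$ and returns a quasi-kernel $Q$ in $D$ such that $|Q|\le \frac{tn}{t+1}$. (In particular every sourceless $D\in\mathcal{H}$ of order $n$ has a quasi-kernel of order at most $\frac{tn}{t+1}$.)
   Context: Digraphs are finite, without loops and without repeated edges $(u,v)$; both $(u,v)$ and $(v,u)$ may be present. The order of a digraph is its number of vertices. $N^+(v)$ is the set of out-neighbours of $v$, $N^+[v]=N^+(v)\cup\{v\}$, and for a vertex set $X$, $N^+(X)=\bigcup_{x\in X}N^+(x)$ and $N^+[X]=X\cup N^+(X)$. A source is a vertex with in-degree zero; a digraph is sourceless if it has no source. For a vertex $v$ of $D$, $S(v)$ denotes the set of sources of the induced subdigraph $D-N^+[v]$. A class of digraphs is hereditary if it is closed under taking induced subgraphs. $\dist(v,u)$ is the length of a shortest directed path from $v$ to $u$ ($\infty$ if none exists). A quasi-kernel of $D$ is an independent set $Q$ (no edges in either direction between vertices of $Q$) such that for every vertex $u$ of $D$ there is $v\in Q$ with $\dist(v,u)\le 2$. For the running time, $D$ is stored as a dictionary keyed by vertices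 giving each vertex's in-neighbourhood and out-neighbourhood as sets, with constant time lookup; $t$ and $\mathcal{H}$ are fixed. *)

theory Defs
  imports "Graph_Theory.Graph_Theory" "HOL-Library.Landau_Symbols"
begin

section \<open>Digraphs and quasi-kernels\<close>

text \<open>Finite digraphs without loops and without parallel arcs are the locale \<open>digraph\<close> of
  Graph_Theory; \<open>u \<rightarrow>\<^bsub>G\<^esub> v\<close> says that \<open>(u, v)\<close> is an edge of \<open>G\<close>, and \<open>G \<restriction> X\<close> is the subdigraph
  induced by \<open>X\<close>.\<close>

definition out_nbrs :: "('a, 'b) pre_digraph \<Rightarrow> 'a \<Rightarrow> 'a set" where
  "out_nbrs G v = {u. v \<rightarrow>\<^bsub>G\<^esub> u}"

definition in_nbrs :: "('a, 'b) pre_digraph \<Rightarrow> 'a \<Rightarrow> 'a set" where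
  "in_nbrs G v = {u. u \<rightarrow>\<^bsub>G\<^esub> v}"

definition closed_out_nbrs :: "('a, 'b) pre_digraph \<Rightarrow> 'a \<Rightarrow> 'a set" where
  "closed_out_nbrs G v = insert v (out_nbrs G v)"

definition out_nbrs_of_set :: "('a, 'b) pre_digraph \<Rightarrow> 'a set \<Rightarrow> 'a set" where
  "out_nbrs_of_set G X = (\<Union>x\<in>X. out_nbrs G x)"

definition sources :: "('a, 'b) pre_digraph \<Rightarrow> 'a set" where
  "sources G = {v \<in> verts G. in_degree G v = 0}"

definition sourceless :: "('a, 'b) pre_digraph \<Rightarrow> bool" where
  "sourceless G \<longleftrightarrow> sources G = {}"

definition residual_sources :: "('a, 'b) pre_digraph \<Rightarrow> 'a \<Rightarrow> 'a set" where
  "residual_sources G v = sources (G \<restriction> (verts G - closed_out_nbrs G v))"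

definition hereditary :: "('a, 'b) pre_digraph set \<Rightarrow> bool" where
  "hereditary \<H> \<longleftrightarrow> (\<forall>G\<in>\<H>. \<forall>G'. induced_subgraph G' G \<longrightarrow> G' \<in> \<H>)"

definition vdist :: "('a, 'b) pre_digraph \<Rightarrow> 'a \<Rightarrow> 'a \<Rightarrow> ereal" where
  "vdist G v u = wf_digraph.\<mu> G (\<lambda>_. 1) v u"

definition independent_set :: "('a, 'b) pre_digraph \<Rightarrow> 'a set \<Rightarrow> bool" where
  "independent_set G Q \<longleftrightarrow> Q \<subseteq> verts G \<and> (\<forall>u\<in>Q. \<forall>v\<in>Q. \<not> u \<rightarrow>\<^bsub>G\<^esub> v)"

definition quasi_kernel :: "('a, 'b) pre_digraph \<Rightarrow> 'a set \<Rightarrow> bool" where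
  "quasi_kernel G Q \<longleftrightarrow>
     independent_set G Q \<and> (\<forall>u\<in>verts G. \<exists>v\<in>Q. vdist G v u \<le> 2)"


section \<open>The machine model\<close>

text \<open>A digraph is stored as a dictionary keyed by its vertices, with the in- and the
  out-neighbourhood of each vertex as sets. The lists only fix the (arbitrary) order in which a
  loop runs through the keys or through a neighbourhood; membership is a unit-cost test below.\<close>

record 'a stored_digraph =
  keys :: "'a list"
  in_set :: "'a \<Rightarrow> 'a list"
  out_set :: "'a \<Rightarrow> 'a list"

definition stores :: "'a stored_digraph \<Rightarrow> ('a, 'b) pre_digraph \<Rightarrow> bool" where
  "stores R G \<longleftrightarrow>
     distinct (keys R) \<and> set (keys R) = verts G \<and>
     (\<forall>v\<in>verts G. distinct (in_set R v) \<and> set (in_set R v) = in_nbrs G v \<and>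
                  distinct (out_set R v) \<and> set (out_set R v) = out_nbrs G v)"

text \<open>Algorithms are programs of a unit-cost random access machine with dictionaries. A value is a
  number or a vertex; vertices are opaque and can only be compared for equality, looked up and
  used as keys, so one program serves all vertex types. A dictionary that is indexed by numbers is
  an ordinary array. The only arithmetic operations are increment and decrement: all numbers
  occurring in a computation are therefore bounded by a linear function of the running time, i.e.
  they have logarithmically many bits, and charging one unit per operation is legitimate.\<close>

datatype 'a val = Num nat | Vtx 'a

datatype exp =
    Const nat
  | Reg nat              \<comment> \<open>content of a register\<close>
  | Look nat exp         \<comment> \<open>entry of a dictionary at a key\<close>
  | Inc exp
  | Dec exp

datatype bexp =
    Eq exp exp
  | Less exp exp
  | InMem exp exp        \<comment> \<open>is the first vertex an in-neighbour of the second one?\<close>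
  | OutMem exp exp       \<comment> \<open>is the first vertex an out-neighbour of the second one?\<close>
  | Neg bexp
  | Conj bexp bexp

datatype range = Keys | InSet exp | OutSet exp

datatype com =
    Skip
  | Assign nat exp       \<comment> \<open>write a register\<close>
  | Store nat exp exp    \<comment> \<open>in a dictionary, at a key, write a value\<close>
  | Seq com com
  | Cond bexp com com
  | While bexp com
  | For nat range com    \<comment> \<open>let a register run through a set of vertices\<close>

record 'a state =
  reg :: "nat \<Rightarrow> 'a val"
  dct :: "nat \<Rightarrow> 'a val \<Rightarrow> 'a val"

fun val_inc :: "'a val \<Rightarrow> 'a val" where
  "val_inc (Num n) = Num (Suc n)"
| "val_inc (Vtx v) = Num 0"

fun val_dec :: "'a val \<Rightarrow> 'a val" where
  "val_dec (Num n) = Num (n - 1)"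
| "val_dec (Vtx v) = Num 0"

fun val_less :: "'a val \<Rightarrow> 'a val \<Rightarrow> bool" where
  "val_less (Num m) (Num n) \<longleftrightarrow> m < n"
| "val_less _ _ \<longleftrightarrow> False"

fun val_list :: "('a \<Rightarrow> 'a list) \<Rightarrow> 'a val \<Rightarrow> 'a list" where
  "val_list f (Vtx v) = f v"
| "val_list f (Num n) = []"

primrec eval_exp :: "'a state \<Rightarrow> exp \<Rightarrow> 'a val" where
  "eval_exp s (Const n) = Num n"
| "eval_exp s (Reg x) = reg s x"
| "eval_exp s (Look d e) = dct s d (eval_exp s e)"
| "eval_exp s (Inc e) = val_inc (eval_exp s e)"
| "eval_exp s (Dec e) = val_dec (eval_exp s e)"

primrec eval_bexp :: "'a stored_digraph \<Rightarrow> 'a state \<Rightarrow> bexp \<Rightarrow> bool" where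
  "eval_bexp R s (Eq e f) \<longleftrightarrow> eval_exp s e = eval_exp s f"
| "eval_bexp R s (Less e f) \<longleftrightarrow> val_less (eval_exp s e) (eval_exp s f)"
| "eval_bexp R s (InMem e f) \<longleftrightarrow>
     eval_exp s e \<in> Vtx ` set (val_list (in_set R) (eval_exp s f))"
| "eval_bexp R s (OutMem e f) \<longleftrightarrow>
     eval_exp s e \<in> Vtx ` set (val_list (out_set R) (eval_exp s f))"
| "eval_bexp R s (Neg b) \<longleftrightarrow> \<not> eval_bexp R s b"
| "eval_bexp R s (Conj b c) \<longleftrightarrow> eval_bexp R s b \<and> eval_bexp R s c"

primrec range_list :: "'a stored_digraph \<Rightarrow> 'a state \<Rightarrow> range \<Rightarrow> 'a list" where
  "range_list R s Keys = keys R"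
| "range_list R s (InSet e) = val_list (in_set R) (eval_exp s e)"
| "range_list R s (OutSet e) = val_list (out_set R) (eval_exp s e)"

text \<open>\<open>exec R c s k s'\<close>: on the stored digraph \<open>R\<close>, started in \<open>s\<close>, the program \<open>c\<close> terminates in
  \<open>s'\<close> after \<open>k\<close> steps. One step is an atomic command, a test, the entry to a loop over a set, or
  the advance to its next element; the expressions in a fixed program have bounded size.\<close>

inductive
  exec :: "'a stored_digraph \<Rightarrow> com \<Rightarrow> 'a state \<Rightarrow> nat \<Rightarrow> 'a state \<Rightarrow> bool" and
  iter :: "'a stored_digraph \<Rightarrow> nat \<Rightarrow> com \<Rightarrow> 'a list \<Rightarrow> 'a state \<Rightarrow> nat \<Rightarrow> 'a state \<Rightarrow> bool"
  for R :: "'a stored_digraph"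
where
  Skip: "exec R Skip s 1 s"
| Assign: "exec R (Assign x e) s 1 (s\<lparr>reg := (reg s)(x := eval_exp s e)\<rparr>)"
| Store: "exec R (Store d e f) s 1
            (s\<lparr>dct := (dct s)(d := (dct s d)(eval_exp s e := eval_exp s f))\<rparr>)"
| Seq: "\<lbrakk>exec R c s j s1; exec R d s1 k s2\<rbrakk> \<Longrightarrow> exec R (Seq c d) s (j + k) s2"
| CondTrue: "\<lbrakk>eval_bexp R s b; exec R c s k s1\<rbrakk> \<Longrightarrow> exec R (Cond b c d) s (k + 1) s1"
| CondFalse: "\<lbrakk>\<not> eval_bexp R s b; exec R d s k s1\<rbrakk> \<Longrightarrow> exec R (Cond b c d) s (k + 1) s1"
| WhileTrue: "\<lbrakk>eval_bexp R s b; exec R c s j s1; exec R (While b c) s1 k s2\<rbrakk>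
                \<Longrightarrow> exec R (While b c) s (j + k + 1) s2"
| WhileFalse: "\<not> eval_bexp R s b \<Longrightarrow> exec R (While b c) s 1 s"
| For: "iter R x c (range_list R s r) s k s1 \<Longrightarrow> exec R (For x r c) s (k + 1) s1"
| Nil: "iter R x c [] s 0 s"
| Cons: "\<lbrakk>exec R c (s\<lparr>reg := (reg s)(x := Vtx v)\<rparr>) j s1; iter R x c vs s1 k s2\<rbrakk>
           \<Longrightarrow> iter R x c (v # vs) s (j + k + 1) s2"

text \<open>Execution is deterministic, so the existence of a terminating execution below is total
  correctness.\<close>

lemma exec_iter_deterministic:
  "exec R c s k s' \<Longrightarrow> (\<And>k1 s1. exec R c s k1 s1 \<Longrightarrow> k1 = k \<and> s1 = s')"
  "iter R x c vs s k s' \<Longrightarrow> (\<And>k1 s1. iter R x c vs s k1 s1 \<Longrightarrow> k1 = k \<and> s1 = s')"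
proof (induction rule: exec_iter.inducts)
  case (Seq c s j s1 d k s2)
  from Seq.prems show ?case by (cases rule: exec.cases) (use Seq.IH in blast)+
next
  case (WhileTrue s b c j s1 k s2)
  from WhileTrue.prems show ?case
    by (cases rule: exec.cases) (use WhileTrue in blast)+
next
  case (Cons c s x v j s1 vs k s2)
  from Cons.prems show ?case by (cases rule: iter.cases) (use Cons.IH in blast)+
qed (erule exec.cases iter.cases; fastforce)+

definition init_state :: "'a state" where
  "init_state = \<lparr>reg = (\<lambda>_. Num 0), dct = (\<lambda>_ _. Num 0)\<rparr>"

text \<open>A program returns a vertex set in dictionary 0, whose members are the vertices with an entry
  other than the initial 0.\<close>

definition returned :: "'a state \<Rightarrow> 'a set" where
  "returned s = {v. dct s 0 (Vtx v) \<noteq> Num 0}"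

end

theory Submission
  imports Defs
begin

text \<open>Call \<open>D'\<close> a remainder of a digraph \<open>D\<close> with source set \<open>S\<close> if it arises from \<open>D - N\<^sup>+[S]\<close> by deleting
  some vertices of \<open>W\<close>, the part of \<open>N\<^sup>+(N\<^sup>+(S))\<close> in it: if \<open>Q\<close> is a quasi-kernel of \<open>D'\<close>, then \<open>S \<union> Q\<close> is one
  of \<open>D\<close>. All sources of \<open>D - N\<^sup>+[S]\<close> lie in \<open>W\<close>. Deleting vertices of \<open>W\<close> as long as no vertex outside
  \<open>W\<close> becomes a source, one arrives at a \<open>D'\<close> in which every source \<open>w\<close> is the only in-neighbour of some
  vertex; so its source set \<open>S'\<close> satisfies \<open>|S'| \<le> |N\<^sup>+(S')|\<close>, and since \<open>t \<ge> 1\<close> the next such step again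
  chooses at most the fraction \<open>t / (t + 1)\<close> of the vertices it deletes. If \<open>D\<close> is sourceless, a vertex
  \<open>v\<close> as in the hypothesis is put aside and the step is applied to \<open>D - N\<^sup>+[v]\<close>, whose sources are \<open>S(v)\<close>;
  as in the proof of Chvatal and Lovasz, \<open>v\<close> joins the final set unless this set has an edge to \<open>v\<close>.
  These decisions are made in reverse order at the end. There are at most \<open>n\<close> rounds of cost
  \<open>O(n\<^sup>3)\<close>.\<close>

section \<open>Quasi-kernels and sources of a relation\<close>

text \<open>All digraphs met in the rounds are induced subdigraphs of the input, so each is given by
  one fixed relation \<open>E\<close> and a varying vertex set \<open>A\<close>.\<close>

definition src :: "('a \<Rightarrow> 'a \<Rightarrow> bool) \<Rightarrow> 'a set \<Rightarrow> 'a set" where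
  "src E A = {u \<in> A. \<forall>w\<in>A. \<not> E w u}"

definition nbrs :: "('a \<Rightarrow> 'a \<Rightarrow> bool) \<Rightarrow> 'a set \<Rightarrow> 'a set \<Rightarrow> 'a set" where
  "nbrs E A X = {u \<in> A. \<exists>x\<in>X. E x u}"

definition qkernel :: "('a \<Rightarrow> 'a \<Rightarrow> bool) \<Rightarrow> 'a set \<Rightarrow> 'a set \<Rightarrow> bool" where
  "qkernel E A Q \<longleftrightarrow> Q \<subseteq> A \<and> (\<forall>u\<in>Q. \<forall>v\<in>Q. \<not> E u v) \<and>
     A \<subseteq> Q \<union> nbrs E A Q \<union> nbrs E A (nbrs E A Q)"

definition absorb :: "('a \<Rightarrow> 'a \<Rightarrow> bool) \<Rightarrow> 'a \<Rightarrow> 'a set \<Rightarrow> 'a set" where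
  "absorb E v Q = (if \<exists>q\<in>Q. E q v then Q else insert v Q)"

definition rest :: "('a \<Rightarrow> 'a \<Rightarrow> bool) \<Rightarrow> 'a set \<Rightarrow> 'a \<Rightarrow> 'a set" where
  "rest E A v = {u \<in> A. u \<noteq> v \<and> \<not> E v u}"

definition gain :: "('a \<Rightarrow> 'a \<Rightarrow> bool) \<Rightarrow> 'a set \<Rightarrow> 'a \<Rightarrow> 'a set" where
  "gain E A v = nbrs E A {v} \<union> nbrs E A (src E (rest E A v))"

text \<open>For a vertex \<open>v\<close> of a sourceless digraph, \<open>gain\<close> is \<open>N\<^sup>+(v) \<union> N\<^sup>+(S(v))\<close>, and \<open>loss\<close> is \<open>S(v)\<close> together with
  \<open>v\<close> unless \<open>v \<in> N\<^sup>+(S(v))\<close>; so the two alternatives of the hypothesis both read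
  \<open>card loss \<le> t * card gain\<close>.\<close>

definition loss :: "('a \<Rightarrow> 'a \<Rightarrow> bool) \<Rightarrow> 'a set \<Rightarrow> 'a \<Rightarrow> 'a set" where
  "loss E A v = absorb E v (src E (rest E A v))"

definition core :: "('a \<Rightarrow> 'a \<Rightarrow> bool) \<Rightarrow> 'a set \<Rightarrow> 'a set" where
  "core E A = A - src E A - nbrs E A (src E A)"

definition covered :: "('a \<Rightarrow> 'a \<Rightarrow> bool) \<Rightarrow> 'a set \<Rightarrow> 'a set" where
  "covered E A = nbrs E (core E A) (nbrs E A (src E A))"

text \<open>A vertex \<open>w\<close> of \<open>W\<close> is needed if deleting it makes a source of some vertex outside \<open>W\<close>, i.e. of
  one that still has to be dominated.\<close>

definition needed :: "('a \<Rightarrow> 'a \<Rightarrow> bool) \<Rightarrow> 'a set \<Rightarrow> 'a set \<Rightarrow> 'a \<Rightarrow> bool" where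
  "needed E W A w \<longleftrightarrow> (\<exists>u\<in>A - W. E w u \<and> \<not> (\<exists>y\<in>A. y \<noteq> w \<and> E y u))"

text \<open>Only vertices at distance two from the sources may be dropped, and every source left
  must be such a vertex too. The last clause is maximality: no further vertex can go.\<close>

definition pruned :: "('a \<Rightarrow> 'a \<Rightarrow> bool) \<Rightarrow> 'a set \<Rightarrow> 'a set \<Rightarrow> bool" where
  "pruned E A A' \<longleftrightarrow> A' \<subseteq> core E A \<and> core E A - A' \<subseteq> covered E A \<and>
     src E A' \<subseteq> covered E A \<and> (\<forall>w\<in>A' \<inter> covered E A. needed E (covered E A) A' w)"

section \<open>Quasi-kernels assembled from smaller ones\<close>

text \<open>A vertex of the core has an in-neighbour in \<open>A\<close>, but none in
  \<open>src E A\<close>. If it has none in the core either, one lies in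
  \<open>nbrs E A (src E A)\<close>.\<close>

lemma src_core: "src E (core E A) \<subseteq> covered E A"
  unfolding src_def core_def covered_def nbrs_def by blast

text \<open>Every source left after pruning is needed, hence has a private out-neighbour.\<close>

lemma pruned_sources:
  assumes "pruned E A A'" "finite A'"
  shows "card (src E A') \<le> card (nbrs E A' (src E A'))"
proof -
  let ?W = "covered E A"
  have "\<forall>w\<in>src E A'. \<exists>u\<in>A' - ?W. E w u \<and> \<not> (\<exists>y\<in>A'. y \<noteq> w \<and> E y u)"
    using assms unfolding pruned_def needed_def src_def by blast
  then obtain f where f: "\<And>w. w \<in> src E A' \<Longrightarrow>
      f w \<in> A' \<and> E w (f w) \<and> \<not> (\<exists>y\<in>A'. y \<noteq> w \<and> E y (f w))" by (metis DiffD1)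
  \<comment> \<open>The only in-neighbour of \<open>f w\<close> in \<open>A'\<close> is
    \<open>w\<close>, so \<open>f w\<close> determines \<open>w\<close>.\<close>
  have "inj_on f (src E A')"
    by (rule inj_onI) (metis (no_types, lifting) f mem_Collect_eq src_def)
  moreover have "f ` src E A' \<subseteq> nbrs E A' (src E A')" using f unfolding nbrs_def by auto
  ultimately show ?thesis
    using assms(2) by (intro card_inj_on_le) (auto simp: nbrs_def)
qed

text \<open>Sources have no in-neighbours in \<open>A\<close> and the core contains none of their
  out-neighbours, which gives independence; the dropped vertices are reached from the sources in two
  steps.\<close>

lemma qkernel_add_sources:
  assumes "qkernel E A' Q" "pruned E A A'"
  shows "qkernel E A (src E A \<union> Q)"
  unfolding qkernel_def
proof (intro conjI ballI)
  have Q: "Q \<subseteq> A'" "\<And>u v. u \<in> Q \<Longrightarrow> v \<in> Q \<Longrightarrow> \<not> E u v"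
    "A' \<subseteq> Q \<union> nbrs E A' Q \<union> nbrs E A' (nbrs E A' Q)"
    using assms(1) unfolding qkernel_def by auto
  have A': "A' \<subseteq> core E A" and W: "core E A - A' \<subseteq> covered E A"
    using assms(2) unfolding pruned_def by auto
  show "src E A \<union> Q \<subseteq> A" using Q(1) A' unfolding core_def src_def by auto
  show "\<not> E u v" if "u \<in> src E A \<union> Q" "v \<in> src E A \<union> Q" for u v
    using that Q(1,2) A' unfolding core_def src_def nbrs_def by blast
  have mono: "nbrs E A' X \<subseteq> nbrs E A Y" if "X \<subseteq> Y" for X Y
    using that A' unfolding nbrs_def core_def by blast
  have "A' \<subseteq> src E A \<union> Q \<union> nbrs E A (src E A \<union> Q) \<union> nbrs E A (nbrs E A (src E A \<union> Q))"
    using Q(3) mono[of Q "src E A \<union> Q"] mono[OF mono[of Q "src E A \<union> Q"]] by blast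
  moreover have "covered E A \<subseteq> nbrs E A (nbrs E A (src E A \<union> Q))"
    unfolding covered_def core_def nbrs_def by blast
  moreover have "nbrs E A (src E A) \<subseteq> nbrs E A (src E A \<union> Q)"
    unfolding nbrs_def by blast
  ultimately show "A \<subseteq> src E A \<union> Q \<union> nbrs E A (src E A \<union> Q) \<union> nbrs E A (nbrs E A (src E A \<union> Q))"
    using W unfolding core_def by blast
qed

text \<open>Either \<open>v\<close> is chosen or a chosen vertex has an edge to \<open>v\<close>; in
  both cases the out-neighbours of \<open>v\<close> are at distance at most two. Edges from
  \<open>v\<close> into \<open>Q\<close> are excluded by \<open>rest\<close>.\<close>

lemma qkernel_absorb:
  assumes "qkernel E (rest E A v) Q" "v \<in> A" "\<not> E v v"
  shows "qkernel E A (absorb E v Q)"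
proof -
  have Q: "Q \<subseteq> rest E A v" "\<And>u v. u \<in> Q \<Longrightarrow> v \<in> Q \<Longrightarrow> \<not> E u v"
    "\<And>u. u \<in> rest E A v \<Longrightarrow> u \<in> Q \<union> nbrs E (rest E A v) Q \<union> nbrs E (rest E A v) (nbrs E (rest E A v) Q)"
    using assms(1) unfolding qkernel_def by auto
  have sub: "Q \<subseteq> absorb E v Q" unfolding absorb_def by auto
  have "u \<in> absorb E v Q \<union> nbrs E A (absorb E v Q) \<union> nbrs E A (nbrs E A (absorb E v Q))"
    if "u \<in> A" for u
  proof (cases "u \<in> rest E A v")
    case True
    then show ?thesis using Q(3)[OF True] sub unfolding nbrs_def rest_def by blast
  next
    case False
    then have "u = v \<or> E v u" using that unfolding rest_def by auto
    moreover have "v \<in> absorb E v Q \<or> v \<in> nbrs E A (absorb E v Q)"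
      using assms(2) unfolding absorb_def nbrs_def by auto
    ultimately show ?thesis using that unfolding nbrs_def by blast
  qed
  moreover have "absorb E v Q \<subseteq> A" using Q(1) assms(2) unfolding absorb_def rest_def by auto
  moreover have "\<not> E x y" if "x \<in> absorb E v Q" "y \<in> absorb E v Q" for x y
    using that Q(1,2) assms(3) unfolding absorb_def rest_def by (auto split: if_splits)
  ultimately show ?thesis unfolding qkernel_def by auto
qed

section \<open>Vertices chosen against vertices deleted\<close>

lemma card_sources_step:
  fixes t :: real
  assumes "t \<ge> 1" "finite A" "pruned E A A'" "finite Q"
    and le: "card (src E A) \<le> card (nbrs E A (src E A))"
  shows "(t + 1) * real (card (src E A \<union> Q))
    \<le> (t + 1) * real (card Q) + t * (real (card A) - real (card A'))"
proof -
  let ?S = "src E A" and ?N = "nbrs E A (src E A)"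
  have sub: "?S \<subseteq> A" "?N \<subseteq> A" "?S \<inter> ?N = {}" "A' \<subseteq> A - (?S \<union> ?N)"
    using assms(3) unfolding pruned_def core_def src_def nbrs_def by auto
  have "card A' \<le> card (A - (?S \<union> ?N))" using sub assms(2) by (intro card_mono) auto
  also have "\<dots> = card A - (card ?S + card ?N)"
    using sub assms(2) by (subst card_Diff_subset) (auto simp: card_Un_disjoint finite_subset)
  finally have *: "card A' \<le> card A - (card ?S + card ?N)" .
  have "card ?S + card ?N \<le> card A"
    using sub assms(2) by (metis Un_least card_Un_disjoint card_mono finite_subset)
  with * have 1: "real (card ?S) + real (card ?N) \<le> real (card A) - real (card A')"
    by linarith
  have "(t + 1) * real (card ?S) = t * card ?S + card ?S" by (simp add: algebra_simps)
  \<comment> \<open>Here \<open>t \<ge> 1\<close> is used, to pass from \<open>card ?N\<close> to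
    \<open>t * card ?N\<close>.\<close>
  also have "\<dots> \<le> t * card ?S + t * card ?N"
    using le assms(1) mult_mono[of 1 t "real (card ?S)" "real (card ?N)"] by simp
  also have "\<dots> \<le> t * (real (card A) - real (card A'))"
    using 1 assms(1) mult_left_mono[OF 1, of t] by (simp add: algebra_simps)
  finally have 2: "(t + 1) * real (card ?S) \<le> t * (real (card A) - real (card A'))" .
  have "real (card (?S \<union> Q)) \<le> real (card ?S) + real (card Q)"
    by (metis card_Un_le of_nat_add of_nat_le_iff)
  then have "(t + 1) * real (card (?S \<union> Q)) \<le> (t + 1) * (real (card ?S) + real (card Q))"
    using assms(1) by (intro mult_left_mono) auto
  then show ?thesis using 2 by (simp add: algebra_simps)
qed

text \<open>\<open>loss\<close> and \<open>gain\<close> are disjoint and both deleted;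
  \<open>v\<close> is paid for by \<open>loss\<close> exactly when no source of
  \<open>rest E A v\<close> has an edge to it.\<close>

lemma card_absorb_step:
  fixes t :: real
  assumes "t \<ge> 1" "finite A" "v \<in> A" "\<not> E v v" "pruned E (rest E A v) A'" "finite Q"
    and le: "real (card (loss E A v)) \<le> t * real (card (gain E A v))"
  shows "(t + 1) * real (card (absorb E v (src E (rest E A v) \<union> Q)))
    \<le> (t + 1) * real (card Q) + t * (real (card A) - real (card A'))"
proof -
  let ?L = "loss E A v" and ?G = "gain E A v"
  have sub: "?L \<subseteq> A" "?G \<subseteq> A" "?L \<inter> ?G = {}" "A' \<subseteq> A - (?L \<union> ?G)"
    using assms(3-5) unfolding pruned_def core_def src_def nbrs_def loss_def gain_def absorb_def rest_def
    by (auto split: if_splits)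
  have "card A' \<le> card (A - (?L \<union> ?G))" using sub assms(2) by (intro card_mono) auto
  also have "\<dots> = card A - (card ?L + card ?G)"
    using sub assms(2) by (subst card_Diff_subset) (auto simp: card_Un_disjoint finite_subset)
  finally have *: "card A' \<le> card A - (card ?L + card ?G)" .
  have "card ?L + card ?G \<le> card A"
    using sub assms(2) by (metis Un_least card_Un_disjoint card_mono finite_subset)
  with * have 1: "real (card ?L) + real (card ?G) \<le> real (card A) - real (card A')"
    by linarith
  have "(t + 1) * real (card ?L) = t * card ?L + card ?L" by (simp add: algebra_simps)
  also have "\<dots> \<le> t * (real (card A) - real (card A'))"
    using le 1 assms(1) mult_left_mono[OF 1, of t] by (simp add: algebra_simps)
  finally have 2: "(t + 1) * real (card ?L) \<le> t * (real (card A) - real (card A'))" .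
  \<comment> \<open>An edge from \<open>Q\<close> to \<open>v\<close> can only keep \<open>v\<close>
    out.\<close>
  have "absorb E v (src E (rest E A v) \<union> Q) \<subseteq> ?L \<union> Q"
    unfolding loss_def absorb_def by auto
  then have "card (absorb E v (src E (rest E A v) \<union> Q)) \<le> card ?L + card Q"
    by (meson assms(2,6) card_Un_le card_mono finite_UnI finite_subset le_trans sub(1))
  then have "(t + 1) * real (card (absorb E v (src E (rest E A v) \<union> Q))) \<le> (t + 1) * (real (card ?L) + real (card Q))"
    using assms(1) by (intro mult_left_mono) auto
  then show ?thesis using 2 by (simp add: algebra_simps)
qed

section \<open>The stack and the invariant of the rounds\<close>

text \<open>With \<open>foldr\<close> the last vertex of the list, the one put aside last, is
  absorbed first.\<close>

definition unwind :: "('a \<Rightarrow> 'a \<Rightarrow> bool) \<Rightarrow> 'a list \<Rightarrow> 'a set \<Rightarrow> 'a set" where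
  "unwind E vs Q = foldr (absorb E) vs Q"

text \<open>\<open>A\<close> is the set of vertices still present, \<open>K\<close> the vertices chosen for good and \<open>vs\<close> the stack of
  vertices whose membership depends on the choices made after them. No edge runs from \<open>K\<close> to \<open>A\<close>, so
  \<open>K\<close> may be added before or after an absorption.\<close>

definition round_inv :: "('a \<Rightarrow> 'a \<Rightarrow> bool) \<Rightarrow> 'a set \<Rightarrow> real \<Rightarrow> 'a set \<Rightarrow> 'a set \<Rightarrow> 'a list \<Rightarrow> bool" where
  "round_inv E V t A K vs \<longleftrightarrow> A \<subseteq> V \<and> K \<subseteq> V \<and> set vs \<subseteq> V \<and>
     (\<forall>q\<in>K. \<forall>u\<in>A. \<not> E q u) \<and>
     card (src E A) \<le> card (nbrs E A (src E A)) \<and>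
     (\<forall>Q. qkernel E A Q \<longrightarrow> qkernel E V (unwind E vs (K \<union> Q)) \<and>
       (t + 1) * real (card (unwind E vs (K \<union> Q)))
         \<le> (t + 1) * real (card Q) + t * (real (card V) - real (card A)))"

lemma pruned_no_edge:
  assumes "pruned E A A'" "q \<in> src E A" "u \<in> A'" shows "\<not> E q u"
  using assms unfolding pruned_def core_def nbrs_def by auto

lemma pruned_subset: "pruned E A A' \<Longrightarrow> A' \<subseteq> A - src E A"
  unfolding pruned_def core_def by auto

text \<open>A quasi-kernel of \<open>A'\<close> together with the sources is one of
  \<open>A\<close>, to which the old invariant applies; the size bounds telescope.\<close>

lemma round_inv_sources:
  assumes inv: "round_inv E V t A K vs" and "finite V" "t \<ge> 1" "pruned E A A'"
  shows "round_inv E V t A' (K \<union> src E A) vs"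
  unfolding round_inv_def
proof (intro conjI allI impI)
  have fin: "finite A" "finite A'"
    using assms pruned_subset[OF assms(4)] unfolding round_inv_def by (auto intro: finite_subset)
  show "A' \<subseteq> V" "K \<union> src E A \<subseteq> V" "set vs \<subseteq> V"
    using inv pruned_subset[OF assms(4)] unfolding round_inv_def src_def by auto
  show "\<forall>q\<in>K \<union> src E A. \<forall>u\<in>A'. \<not> E q u"
    using inv pruned_subset[OF assms(4)] pruned_no_edge[OF assms(4)] unfolding round_inv_def by auto
  show "card (src E A') \<le> card (nbrs E A' (src E A'))" using pruned_sources assms(4) fin by blast
  fix Q assume Q: "qkernel E A' Q"
  let ?Q = "src E A \<union> Q"
  have "finite Q" using Q fin unfolding qkernel_def by (auto intro: finite_subset)
  then have "(t + 1) * real (card ?Q) \<le> (t + 1) * real (card Q) + t * (real (card A) - real (card A'))"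
    using card_sources_step[OF assms(3) fin(1) assms(4)] inv unfolding round_inv_def by blast
  moreover have "qkernel E V (unwind E vs (K \<union> ?Q)) \<and> (t + 1) * real (card (unwind E vs (K \<union> ?Q)))
      \<le> (t + 1) * real (card ?Q) + t * (real (card V) - real (card A))"
    using inv qkernel_add_sources[OF Q assms(4)] unfolding round_inv_def by simp
  ultimately show "qkernel E V (unwind E vs (K \<union> src E A \<union> Q))"
    "(t + 1) * real (card (unwind E vs (K \<union> src E A \<union> Q)))
      \<le> (t + 1) * real (card Q) + t * (real (card V) - real (card A'))"
    by (auto simp: Un_assoc algebra_simps)
qed

lemma round_inv_vertex:
  assumes inv: "round_inv E V t A K vs" and "finite V" "t \<ge> 1" "v \<in> A" "\<not> E v v"
    and "real (card (loss E A v)) \<le> t * real (card (gain E A v))"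
    and pr: "pruned E (rest E A v) A'"
  shows "round_inv E V t A' (K \<union> src E (rest E A v)) (vs @ [v])"
  unfolding round_inv_def
proof (intro conjI allI impI)
  have sub: "A' \<subseteq> A" "src E (rest E A v) \<subseteq> A"
    using pruned_subset[OF pr] unfolding rest_def src_def by auto
  have fin: "finite A" "finite A'"
    using assms sub unfolding round_inv_def by (auto intro: finite_subset)
  show "A' \<subseteq> V" "K \<union> src E (rest E A v) \<subseteq> V" "set (vs @ [v]) \<subseteq> V"
    using inv sub assms(4) unfolding round_inv_def by auto
  show "\<forall>q\<in>K \<union> src E (rest E A v). \<forall>u\<in>A'. \<not> E q u"
    using inv sub pruned_no_edge[OF pr] unfolding round_inv_def by auto
  show "card (src E A') \<le> card (nbrs E A' (src E A'))" using pruned_sources pr fin by blast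
  fix Q assume Q: "qkernel E A' Q"
  let ?Q = "absorb E v (src E (rest E A v) \<union> Q)"
  have "finite Q" using Q fin unfolding qkernel_def by (auto intro: finite_subset)
  then have "(t + 1) * real (card ?Q) \<le> (t + 1) * real (card Q) + t * (real (card A) - real (card A'))"
    using card_absorb_step[OF assms(3) fin(1) assms(4,5) pr _ assms(6)] by simp
  moreover have "qkernel E V (unwind E vs (K \<union> ?Q)) \<and> (t + 1) * real (card (unwind E vs (K \<union> ?Q)))
      \<le> (t + 1) * real (card ?Q) + t * (real (card V) - real (card A))"
    using inv qkernel_absorb[OF qkernel_add_sources[OF Q pr] assms(4,5)] unfolding round_inv_def by simp
  \<comment> \<open>Since \<open>v\<close> lies in \<open>A\<close>, no edge runs from
    \<open>K\<close> to \<open>v\<close>, so \<open>K\<close> does not affect the decision on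
    \<open>v\<close>.\<close>
  moreover have "K \<union> ?Q = absorb E v (K \<union> src E (rest E A v) \<union> Q)"
    using inv assms(4) unfolding round_inv_def absorb_def by auto
  ultimately show "qkernel E V (unwind E (vs @ [v]) (K \<union> src E (rest E A v) \<union> Q))"
    "(t + 1) * real (card (unwind E (vs @ [v]) (K \<union> src E (rest E A v) \<union> Q)))
      \<le> (t + 1) * real (card Q) + t * (real (card V) - real (card A'))"
    by (auto simp: unwind_def algebra_simps)
qed

lemma round_inv_init:
  assumes "src E V = {}" shows "round_inv E V t V {} []"
  using assms unfolding round_inv_def by (auto simp: unwind_def)

section \<open>Programs built from loops over the vertices\<close>

text \<open>Such programs always terminate, within a number of steps bounded in terms of the number
  of keys alone; so they have a state function \<open>sem\<close> and a bound \<open>cost\<close>,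
  and derivations of \<open>exec\<close> can be avoided.\<close>

primrec for_keys_only :: "com \<Rightarrow> bool" where
  "for_keys_only Skip \<longleftrightarrow> True"
| "for_keys_only (Assign x e) \<longleftrightarrow> True"
| "for_keys_only (Store d e f) \<longleftrightarrow> True"
| "for_keys_only (Seq c d) \<longleftrightarrow> for_keys_only c \<and> for_keys_only d"
| "for_keys_only (Cond b c d) \<longleftrightarrow> for_keys_only c \<and> for_keys_only d"
| "for_keys_only (While b c) \<longleftrightarrow> False"
| "for_keys_only (For x r c) \<longleftrightarrow> r = Keys \<and> for_keys_only c"

text \<open>The values of \<open>sem\<close>, \<open>cost\<close> and \<open>depth\<close> at \<open>While\<close> are irrelevant.\<close>

primrec sem :: "'a stored_digraph \<Rightarrow> com \<Rightarrow> 'a state \<Rightarrow> 'a state" where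
  "sem R Skip = (\<lambda>s. s)"
| "sem R (Assign x e) = (\<lambda>s. s\<lparr>reg := (reg s)(x := eval_exp s e)\<rparr>)"
| "sem R (Store d e f) = (\<lambda>s. s\<lparr>dct := (dct s)(d := (dct s d)(eval_exp s e := eval_exp s f))\<rparr>)"
| "sem R (Seq c d) = (\<lambda>s. sem R d (sem R c s))"
| "sem R (Cond b c d) = (\<lambda>s. if eval_bexp R s b then sem R c s else sem R d s)"
| "sem R (While b c) = (\<lambda>s. s)"
| "sem R (For x r c) =
     (\<lambda>s. fold (\<lambda>v s. sem R c (s\<lparr>reg := (reg s)(x := Vtx v)\<rparr>)) (range_list R s r) s)"

primrec cost :: "nat \<Rightarrow> com \<Rightarrow> nat" where
  "cost n Skip = 1"
| "cost n (Assign x e) = 1"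
| "cost n (Store d e f) = 1"
| "cost n (Seq c d) = cost n c + cost n d"
| "cost n (Cond b c d) = cost n c + cost n d + 1"
| "cost n (While b c) = 0"
| "cost n (For x r c) = n * (cost n c + 1) + 1"

primrec depth :: "com \<Rightarrow> nat" where
  "depth Skip = 0"
| "depth (Assign x e) = 0"
| "depth (Store d e f) = 0"
| "depth (Seq c d) = max (depth c) (depth d)"
| "depth (Cond b c d) = max (depth c) (depth d)"
| "depth (While b c) = 0"
| "depth (For x r c) = Suc (depth c)"

lemma exec_sem:
  "for_keys_only c \<Longrightarrow> \<exists>k. exec R c s k (sem R c s) \<and> k \<le> cost (length (keys R)) c"
proof (induction c arbitrary: s)
  case (Seq c d)
  then obtain j k where "exec R c s j (sem R c s)" "j \<le> cost (length (keys R)) c"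
    "exec R d (sem R c s) k (sem R d (sem R c s))" "k \<le> cost (length (keys R)) d"
    by (metis for_keys_only.simps(4))
  then have "exec R (Seq c d) s (j + k) (sem R (Seq c d) s)" by (auto intro: exec_iter.Seq)
  then show ?case using \<open>j \<le> _\<close> \<open>k \<le> _\<close> by (intro exI[of _ "j + k"]) auto
next
  case (Cond b c d)
  obtain j k where "exec R c s j (sem R c s)" "j \<le> cost (length (keys R)) c"
    "exec R d s k (sem R d s)" "k \<le> cost (length (keys R)) d"
    using Cond by (metis for_keys_only.simps(5))
  then show ?case
    by (cases "eval_bexp R s b") (fastforce intro: exec_iter.CondTrue exec_iter.CondFalse)+
next
  case (For x r c)
  let ?f = "\<lambda>v s. sem R c (s\<lparr>reg := (reg s)(x := Vtx v)\<rparr>)"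
  \<comment> \<open>The list is arbitrary for the sake of induction; the loop itself is the case
    \<open>keys R\<close>.\<close>
  have "\<exists>k. iter R x c vs s k (fold ?f vs s) \<and> k \<le> length vs * (cost (length (keys R)) c + 1)" for vs
  proof (induction vs arbitrary: s)
    case Nil
    then show ?case by (auto intro: exec_iter.Nil)
  next
    case (Cons v vs)
    obtain j where j: "exec R c (s\<lparr>reg := (reg s)(x := Vtx v)\<rparr>) j (?f v s)"
      "j \<le> cost (length (keys R)) c" using For by auto
    obtain k where "iter R x c vs (?f v s) k (fold ?f vs (?f v s))"
      "k \<le> length vs * (cost (length (keys R)) c + 1)" using Cons.IH by blast
    then have "iter R x c (v # vs) s (j + k + 1) (fold ?f (v # vs) s)"
      using exec_iter.Cons[OF j(1)] by (simp del: fun_upd_apply)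
    moreover have "j + k + 1 \<le> length (v # vs) * (cost (length (keys R)) c + 1)"
      using j(2) \<open>k \<le> _\<close> by simp
    ultimately show ?case by blast
  qed
  from this[of "keys R"] obtain k where "iter R x c (keys R) s k (fold ?f (keys R) s)"
    "k \<le> length (keys R) * (cost (length (keys R)) c + 1)" by blast
  then show ?case using For.prems exec_iter.For[of R x c s r k]
    by (intro exI[of _ "k + 1"]) auto
qed (auto intro: exec_iter.intros)

text \<open>The degree is the nesting depth of the loops. The base \<open>n + 1\<close> keeps all
  powers at least 1, so that constants and lower powers are absorbed even for
  \<open>n = 0\<close>.\<close>

lemma cost_le_power: "\<exists>C. \<forall>n. cost n c \<le> C * (n + 1) ^ depth c"
proof (induction c)
  case (Seq c d)
  then obtain C D where C: "\<And>n. cost n c \<le> C * (n + 1) ^ depth c"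
    and D: "\<And>n. cost n d \<le> D * (n + 1) ^ depth d" by blast
  have "cost n (Seq c d) \<le> (C + D) * (n + 1) ^ depth (Seq c d)" for n
  proof -
    have "cost n c + cost n d \<le> C * (n + 1) ^ depth c + D * (n + 1) ^ depth d"
      using C D add_mono by blast
    also have "\<dots> \<le> C * (n + 1) ^ depth (Seq c d) + D * (n + 1) ^ depth (Seq c d)"
      by (intro add_mono mult_left_mono power_increasing) auto
    finally show ?thesis by (simp add: algebra_simps)
  qed
  then show ?case by blast
next
  case (Cond b c d)
  then obtain C D where C: "\<And>n. cost n c \<le> C * (n + 1) ^ depth c"
    and D: "\<And>n. cost n d \<le> D * (n + 1) ^ depth d" by blast
  have "cost n (Cond b c d) \<le> (C + D + 1) * (n + 1) ^ depth (Cond b c d)" for n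
  proof -
    have "cost n c + cost n d + 1 \<le> C * (n + 1) ^ depth c + D * (n + 1) ^ depth d + 1"
      using C D add_mono by (metis add_le_mono1)
    also have "\<dots> \<le> C * (n + 1) ^ depth (Cond b c d) + D * (n + 1) ^ depth (Cond b c d)
        + (n + 1) ^ depth (Cond b c d)"
      by (intro add_mono mult_left_mono power_increasing one_le_power) auto
    finally show ?thesis by (simp add: algebra_simps)
  qed
  then show ?case by blast
next
  case (For x r c)
  then obtain C where C: "\<And>n. cost n c \<le> C * (n + 1) ^ depth c" by blast
  have "cost n (For x r c) \<le> (C + 1) * (n + 1) ^ depth (For x r c)" for n
  proof -
    have 1: "1 \<le> (n + 1) ^ depth c" by simp
    have "n * (cost n c + 1) + 1 \<le> (n + 1) * (cost n c + 1)" by simp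
    also have "\<dots> \<le> (n + 1) * (C * (n + 1) ^ depth c + (n + 1) ^ depth c)"
      using C 1 by (intro mult_left_mono add_mono) auto
    finally show ?thesis by (simp add: algebra_simps)
  qed
  then show ?case by blast
qed (auto intro: exI[of _ 1])

text \<open>The invariant depends on the set of elements visited and not on their order, because the
  order of a dictionary is arbitrary.\<close>

lemma fold_set_invariant:
  assumes "distinct xs" "Inv {} s"
    and "\<And>X v s. \<lbrakk>X \<subseteq> set xs; v \<in> set xs; v \<notin> X; Inv X s\<rbrakk> \<Longrightarrow> Inv (insert v X) (f v s)"
  shows "Inv (set xs) (fold f xs s)"
proof -
  have "Inv (X \<union> set ys) (fold f ys s)"
    if "Inv X s" "distinct ys" "X \<inter> set ys = {}" "X \<union> set ys \<subseteq> set xs" for X ys s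
    using that
  proof (induction ys arbitrary: X s)
    case (Cons y ys)
    then have "Inv (insert y X) (f y s)" using assms(3) by auto
    from Cons.IH[OF this] Cons.prems show ?case by auto
  qed auto
  from this[of "{}" s xs] assms show ?thesis by auto
qed

lemma sem_For_keys:
  assumes "distinct (keys R)" "Inv {} s"
    and "\<And>X v s. \<lbrakk>X \<subseteq> set (keys R); v \<in> set (keys R); v \<notin> X; Inv X s\<rbrakk>
      \<Longrightarrow> Inv (insert v X) (sem R c (s\<lparr>reg := (reg s)(x := Vtx v)\<rparr>))"
  shows "Inv (set (keys R)) (sem R (For x Keys c) s)"
  using fold_set_invariant[where f = "\<lambda>v s. sem R c (s\<lparr>reg := (reg s)(x := Vtx v)\<rparr>)", OF assms]
  by simp

section \<open>Vertex sets in dictionaries and loops over pairs\<close>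

definition mem :: "'a stored_digraph \<Rightarrow> 'a state \<Rightarrow> nat \<Rightarrow> 'a set" where
  "mem R s d = {u \<in> set (keys R). dct s d (Vtx u) \<noteq> Num 0}"

definition In :: "nat \<Rightarrow> exp \<Rightarrow> bexp" where
  "In d e = Neg (Eq (Look d e) (Const 0))"

definition Or :: "bexp \<Rightarrow> bexp \<Rightarrow> bexp" where
  "Or b c = Neg (Conj (Neg b) (Neg c))"

text \<open>What a test reads: if a loop body writes nothing of it, the test keeps its value
  throughout the loop.\<close>

primrec exp_dicts :: "exp \<Rightarrow> nat set" where
  "exp_dicts (Const n) = {}"
| "exp_dicts (Reg x) = {}"
| "exp_dicts (Look d e) = insert d (exp_dicts e)"
| "exp_dicts (Inc e) = exp_dicts e"
| "exp_dicts (Dec e) = exp_dicts e"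

primrec dicts :: "bexp \<Rightarrow> nat set" where
  "dicts (Eq e f) = exp_dicts e \<union> exp_dicts f"
| "dicts (Less e f) = exp_dicts e \<union> exp_dicts f"
| "dicts (InMem e f) = exp_dicts e \<union> exp_dicts f"
| "dicts (OutMem e f) = exp_dicts e \<union> exp_dicts f"
| "dicts (Neg b) = dicts b"
| "dicts (Conj b c) = dicts b \<union> dicts c"

primrec exp_regs :: "exp \<Rightarrow> nat set" where
  "exp_regs (Const n) = {}"
| "exp_regs (Reg x) = {x}"
| "exp_regs (Look d e) = exp_regs e"
| "exp_regs (Inc e) = exp_regs e"
| "exp_regs (Dec e) = exp_regs e"

primrec regs :: "bexp \<Rightarrow> nat set" where
  "regs (Eq e f) = exp_regs e \<union> exp_regs f"
| "regs (Less e f) = exp_regs e \<union> exp_regs f"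
| "regs (InMem e f) = exp_regs e \<union> exp_regs f"
| "regs (OutMem e f) = exp_regs e \<union> exp_regs f"
| "regs (Neg b) = regs b"
| "regs (Conj b c) = regs b \<union> regs c"

lemma eval_exp_cong:
  assumes "\<And>x. x \<in> exp_regs e \<Longrightarrow> reg s x = reg s' x" "\<And>d. d \<in> exp_dicts e \<Longrightarrow> dct s d = dct s' d"
  shows "eval_exp s e = eval_exp s' e"
  using assms by (induction e) auto

lemma eval_bexp_cong:
  assumes "\<And>x. x \<in> regs b \<Longrightarrow> reg s x = reg s' x" "\<And>d. d \<in> dicts b \<Longrightarrow> dct s d = dct s' d"
  shows "eval_bexp R s b = eval_bexp R s' b"
  using assms
proof (induction b)
  case (Eq e f) then show ?case using eval_exp_cong[of e s s'] eval_exp_cong[of f s s'] by auto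
next
  case (Less e f) then show ?case using eval_exp_cong[of e s s'] eval_exp_cong[of f s s'] by auto
next
  case (InMem e f) then show ?case using eval_exp_cong[of e s s'] eval_exp_cong[of f s s'] by auto
next
  case (OutMem e f) then show ?case using eval_exp_cong[of e s s'] eval_exp_cong[of f s s'] by auto
qed auto

definition at2 :: "'a state \<Rightarrow> 'a \<Rightarrow> 'a \<Rightarrow> 'a state" where
  "at2 s u w = s\<lparr>reg := (reg s)(0 := Vtx u, 1 := Vtx w)\<rparr>"

text \<open>Registers 0 and 1 are reserved for loops over all pairs of vertices.\<close>

definition For_pairs :: "bexp \<Rightarrow> com \<Rightarrow> com" where
  "For_pairs b c = For 0 Keys (For 1 Keys (Cond b c Skip))"

text \<open>The inner loop makes register 1 existentially quantified, so one test can describe a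
  neighbourhood of a set.\<close>

definition Add :: "nat \<Rightarrow> bexp \<Rightarrow> com" where
  "Add d b = For_pairs b (Store d (Reg 0) (Const 1))"

definition Clear :: "nat \<Rightarrow> com" where
  "Clear d = For 0 Keys (Store d (Reg 0) (Const 0))"

definition Collect_in :: "nat \<Rightarrow> bexp \<Rightarrow> com" where
  "Collect_in d b = Seq (Clear d) (Add d b)"

text \<open>Counting pairs yields products of cardinalities on a machine that can only
  increment.\<close>

definition Count :: "nat \<Rightarrow> bexp \<Rightarrow> com" where
  "Count r b = Seq (Assign r (Const 0)) (For_pairs b (Assign r (Inc (Reg r))))"

text \<open>The nested loops act as one loop over pairs: within the round of \<open>u\<close>, the
  visited pairs are \<open>X \<times> ?V \<union> {u} \<times> Y\<close>. By \<open>reg\<close> the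
  invariant ignores the two loop registers, and by \<open>keep\<close> the body leaves the outer
  vertex in place.\<close>

lemma sem_For_pairs:
  assumes dist: "distinct (keys R)" and "Inv {} s"
    and reg: "\<And>Z s s'. \<lbrakk>Inv Z s; dct s' = dct s; \<forall>x>1. reg s' x = reg s x\<rbrakk> \<Longrightarrow> Inv Z s'"
    and keep: "\<And>s. reg (sem R c s) 0 = reg s 0"
    and step: "\<And>Z u w s. \<lbrakk>Z \<subseteq> set (keys R) \<times> set (keys R); (u, w) \<notin> Z;
      u \<in> set (keys R); w \<in> set (keys R); Inv Z s\<rbrakk>
      \<Longrightarrow> Inv (insert (u, w) Z) (if eval_bexp R (at2 s u w) b then sem R c (at2 s u w) else s)"
  shows "Inv (set (keys R) \<times> set (keys R)) (sem R (For_pairs b c) s)"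
  unfolding For_pairs_def
proof (rule sem_For_keys[where Inv = "\<lambda>X s. Inv (X \<times> set (keys R)) s", OF dist])
  let ?V = "set (keys R)"
  show "Inv ({} \<times> ?V) s" using assms(2) by simp
  fix X u and s :: "'a state" assume X: "X \<subseteq> ?V" "u \<in> ?V" "u \<notin> X" "Inv (X \<times> ?V) s"
  let ?I = "\<lambda>Y s. reg s 0 = Vtx u \<and> Inv (X \<times> ?V \<union> {u} \<times> Y) s"
  have "?I ?V (sem R (For 1 Keys (Cond b c Skip)) (s\<lparr>reg := (reg s)(0 := Vtx u)\<rparr>))"
  proof (rule sem_For_keys[where Inv = ?I, OF dist])
    show "?I {} (s\<lparr>reg := (reg s)(0 := Vtx u)\<rparr>)" using reg[OF X(4)] by auto
    fix Y w and s :: "'a state" assume Y: "Y \<subseteq> ?V" "w \<in> ?V" "w \<notin> Y" "?I Y s"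
    have at2: "s\<lparr>reg := (reg s)(1 := Vtx w)\<rparr> = at2 s u w"
      using Y(4) unfolding at2_def by (cases s) (auto simp: fun_upd_twist intro!: ext)
    have Z: "X \<times> ?V \<union> {u} \<times> insert w Y = insert (u, w) (X \<times> ?V \<union> {u} \<times> Y)" by auto
    have "Inv (insert (u, w) (X \<times> ?V \<union> {u} \<times> Y)) (if eval_bexp R (at2 s u w) b then sem R c (at2 s u w) else s)"
    proof (rule step)
      show "X \<times> ?V \<union> {u} \<times> Y \<subseteq> ?V \<times> ?V" "(u, w) \<notin> X \<times> ?V \<union> {u} \<times> Y"
        using X Y by auto
    qed (use X Y in auto)
    \<comment> \<open>Where the test fails, the loop registers have still changed.\<close>
    then have "Inv (insert (u, w) (X \<times> ?V \<union> {u} \<times> Y)) (if eval_bexp R (at2 s u w) b then sem R c (at2 s u w) else at2 s u w)"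
      using reg[of _ s "at2 s u w"] by (auto simp: at2_def split: if_splits)
    then show "?I (insert w Y) (sem R (Cond b c Skip) (s\<lparr>reg := (reg s)(1 := Vtx w)\<rparr>))"
      unfolding at2 Z using keep[of "at2 s u w"] by (auto simp: at2_def)
  qed
  moreover have "X \<times> ?V \<union> {u} \<times> ?V = insert u X \<times> ?V" by auto
  ultimately show "Inv (insert u X \<times> ?V)
      (sem R (For 1 Keys (Cond b c Skip)) (s\<lparr>reg := (reg s)(0 := Vtx u)\<rparr>))" by simp
qed

lemma sem_Add:
  assumes dist: "distinct (keys R)" and "d \<notin> dicts b"
  shows "dct (sem R (Add d b) s) = (dct s)(d := \<lambda>k.
      if k \<in> Vtx ` {u \<in> set (keys R). \<exists>w\<in>set (keys R). eval_bexp R (at2 s u w) b} then Num 1 else dct s d k)"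
    and "x > 1 \<Longrightarrow> reg (sem R (Add d b) s) x = reg s x"
proof -
  let ?V = "set (keys R)"
  let ?I = "\<lambda>Z s' :: 'a state. (\<forall>x>1. reg s' x = reg s x) \<and> dct s' = (dct s)(d := \<lambda>k.
      if k \<in> Vtx ` {u. \<exists>w. (u, w) \<in> Z \<and> eval_bexp R (at2 s u w) b} then Num 1 else dct s d k)"
  have "?I (?V \<times> ?V) (sem R (For_pairs b (Store d (Reg 0) (Const 1))) s)"
  proof (rule sem_For_pairs[OF dist, where Inv = ?I])
    fix Z u w and s' :: "'a state" assume I: "?I Z s'"
    \<comment> \<open>The test does not read the dictionary being filled, so it may be evaluated in
      the initial state.\<close>
    have "eval_bexp R (at2 s' u w) b = eval_bexp R (at2 s u w) b"
      using I assms(2) by (intro eval_bexp_cong) (auto simp: at2_def)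
    then show "?I (insert (u, w) Z) (if eval_bexp R (at2 s' u w) b
        then sem R (Store d (Reg 0) (Const 1)) (at2 s' u w) else s')"
      using I by (auto simp: at2_def fun_eq_iff)
  qed auto
  moreover have "{u. \<exists>w. (u, w) \<in> ?V \<times> ?V \<and> P u w} = {u \<in> ?V. \<exists>w\<in>?V. P u w}" for P by auto
  ultimately show "dct (sem R (Add d b) s) = (dct s)(d := \<lambda>k.
      if k \<in> Vtx ` {u \<in> ?V. \<exists>w\<in>?V. eval_bexp R (at2 s u w) b} then Num 1 else dct s d k)"
    "x > 1 \<Longrightarrow> reg (sem R (Add d b) s) x = reg s x"
    unfolding Add_def by auto
qed

lemma sem_Clear:
  assumes dist: "distinct (keys R)"
  shows "dct (sem R (Clear d) s) = (dct s)(d := \<lambda>k. if k \<in> Vtx ` set (keys R) then Num 0 else dct s d k)"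
    and "x > 0 \<Longrightarrow> reg (sem R (Clear d) s) x = reg s x"
proof -
  let ?I = "\<lambda>X s' :: 'a state. (\<forall>x>0. reg s' x = reg s x) \<and>
    dct s' = (dct s)(d := \<lambda>k. if k \<in> Vtx ` X then Num 0 else dct s d k)"
  have "?I (set (keys R)) (sem R (For 0 Keys (Store d (Reg 0) (Const 0))) s)"
    by (rule sem_For_keys[OF dist, where Inv = ?I]) (auto simp: fun_eq_iff)
  then show "dct (sem R (Clear d) s) = (dct s)(d := \<lambda>k. if k \<in> Vtx ` set (keys R) then Num 0 else dct s d k)"
    "x > 0 \<Longrightarrow> reg (sem R (Clear d) s) x = reg s x" unfolding Clear_def by auto
qed

lemma mem_Add:
  assumes "distinct (keys R)" "d \<notin> dicts b"
  shows "mem R (sem R (Add d b) s) d' = (if d' = d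
    then mem R s d \<union> {u \<in> set (keys R). \<exists>w\<in>set (keys R). eval_bexp R (at2 s u w) b} else mem R s d')"
  using sem_Add(1)[OF assms, of s] by (auto simp: mem_def)

lemma sem_Collect_in:
  assumes "distinct (keys R)" "d \<notin> dicts b"
  shows "mem R (sem R (Collect_in d b) s) d' = (if d' = d
    then {u \<in> set (keys R). \<exists>w\<in>set (keys R). eval_bexp R (at2 s u w) b} else mem R s d')"
    and "d' \<noteq> d \<Longrightarrow> dct (sem R (Collect_in d b) s) d' = dct s d'"
    and "x > 1 \<Longrightarrow> reg (sem R (Collect_in d b) s) x = reg s x"
proof -
  let ?s = "sem R (Clear d) s"
  have "eval_bexp R (at2 ?s u w) b = eval_bexp R (at2 s u w) b" for u w
    using sem_Clear[OF assms(1), where d = d and s = s] assms(2) by (intro eval_bexp_cong) (auto simp: at2_def)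
  moreover have "mem R ?s d' = (if d' = d then {} else mem R s d')" for d'
    using sem_Clear(1)[OF assms(1), where d = d and s = s] by (auto simp: mem_def)
  ultimately show "mem R (sem R (Collect_in d b) s) d' = (if d' = d
    then {u \<in> set (keys R). \<exists>w\<in>set (keys R). eval_bexp R (at2 s u w) b} else mem R s d')"
    by (simp add: Collect_in_def mem_Add[OF assms])
  show "d' \<noteq> d \<Longrightarrow> dct (sem R (Collect_in d b) s) d' = dct s d'"
    "x > 1 \<Longrightarrow> reg (sem R (Collect_in d b) s) x = reg s x"
    by (simp_all add: Collect_in_def sem_Add[OF assms] sem_Clear[OF assms(1)])
qed

lemma sem_Count:
  assumes dist: "distinct (keys R)" and "r > 1" "r \<notin> regs b"
  shows "reg (sem R (Count r b) s) r =
      Num (card {(u, w) \<in> set (keys R) \<times> set (keys R). eval_bexp R (at2 s u w) b})"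
    and "x > 1 \<Longrightarrow> x \<noteq> r \<Longrightarrow> reg (sem R (Count r b) s) x = reg s x"
    and "dct (sem R (Count r b) s) = dct s"
proof -
  let ?V = "set (keys R)"
  let ?I = "\<lambda>Z s' :: 'a state. (\<forall>x>1. x \<noteq> r \<longrightarrow> reg s' x = reg s x) \<and> dct s' = dct s \<and>
    reg s' r = Num (card {p \<in> Z. eval_bexp R (at2 s (fst p) (snd p)) b})"
  have "?I (?V \<times> ?V) (sem R (For_pairs b (Assign r (Inc (Reg r)))) (sem R (Assign r (Const 0)) s))"
  proof (rule sem_For_pairs[OF dist, where Inv = ?I])
    fix Z u w and s' :: "'a state"
    assume Z: "Z \<subseteq> ?V \<times> ?V" "(u, w) \<notin> Z" and I: "?I Z s'"
    have "eval_bexp R (at2 s' u w) b = eval_bexp R (at2 s u w) b"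
    proof (rule eval_bexp_cong)
      fix x assume "x \<in> regs b"
      then have "x \<noteq> r" using assms(3) by blast
      moreover have "x = 0 \<or> x = 1 \<or> x > 1" by linarith
      ultimately show "reg (at2 s' u w) x = reg (at2 s u w) x" using I by (auto simp: at2_def)
    qed (use I in \<open>simp add: at2_def\<close>)
    moreover have "{p \<in> insert (u, w) Z. eval_bexp R (at2 s (fst p) (snd p)) b} =
      (if eval_bexp R (at2 s u w) b then insert (u, w) {p \<in> Z. eval_bexp R (at2 s (fst p) (snd p)) b}
       else {p \<in> Z. eval_bexp R (at2 s (fst p) (snd p)) b})" by auto
    moreover have "finite Z" using Z by (auto intro: finite_subset)
    ultimately show "?I (insert (u, w) Z) (if eval_bexp R (at2 s' u w) b
        then sem R (Assign r (Inc (Reg r))) (at2 s' u w) else s')"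
      using I Z(2) assms(2) by (auto simp: at2_def)
  qed (use assms in auto)
  moreover have "{(u, w) \<in> ?V \<times> ?V. eval_bexp R (at2 s u w) b}
      = {p \<in> ?V \<times> ?V. eval_bexp R (at2 s (fst p) (snd p)) b}" by auto
  ultimately show "reg (sem R (Count r b) s) r =
      Num (card {(u, w) \<in> set (keys R) \<times> set (keys R). eval_bexp R (at2 s u w) b})"
    "x > 1 \<Longrightarrow> x \<noteq> r \<Longrightarrow> reg (sem R (Count r b) s) x = reg s x"
    "dct (sem R (Count r b) s) = dct s"
    unfolding Count_def by auto
qed

definition edge :: "'a stored_digraph \<Rightarrow> 'a \<Rightarrow> 'a \<Rightarrow> bool" where
  "edge R u v \<longleftrightarrow> u \<in> set (in_set R v)"

lemma eval_Or [simp]: "eval_bexp R s (Or b c) \<longleftrightarrow> eval_bexp R s b \<or> eval_bexp R s c"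
  by (simp add: Or_def)

section \<open>The program\<close>

text \<open>Stated for arbitrary values, so that tests can be unfolded before registers are known to
  hold vertices; the rules for \<open>Vtx\<close> then lead to \<open>mem\<close> and
  \<open>edge\<close>.\<close>

definition vmem :: "'a stored_digraph \<Rightarrow> 'a state \<Rightarrow> nat \<Rightarrow> 'a val \<Rightarrow> bool" where
  "vmem R s d k \<longleftrightarrow> dct s d k \<noteq> Num 0"

definition vedge :: "'a stored_digraph \<Rightarrow> 'a val \<Rightarrow> 'a val \<Rightarrow> bool" where
  "vedge R k l \<longleftrightarrow> k \<in> Vtx ` set (val_list (in_set R) l)"

lemma vedge_Vtx [simp]: "vedge R (Vtx u) (Vtx v) \<longleftrightarrow> edge R u v"
  by (auto simp: vedge_def edge_def)

lemma vmem_Vtx [simp]: "u \<in> set (keys R) \<Longrightarrow> vmem R s d (Vtx u) \<longleftrightarrow> u \<in> mem R s d"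
  by (simp add: vmem_def mem_def)

lemma eval_bexp_In [simp]: "eval_bexp R s (In d e) \<longleftrightarrow> vmem R s d (eval_exp s e)"
  by (simp add: vmem_def In_def)

lemma eval_bexp_InMem [simp]: "eval_bexp R s (InMem e f) \<longleftrightarrow> vedge R (eval_exp s e) (eval_exp s f)"
  by (simp add: vedge_def)

declare eval_bexp.simps(3) [simp del]

lemma dicts_In [simp]: "dicts (In d e) = insert d (exp_dicts e)"
  by (simp add: In_def)

lemma dicts_Or [simp]: "dicts (Or b c) = dicts b \<union> dicts c"
  by (simp add: Or_def)

lemma regs_In [simp]: "regs (In d e) = exp_regs e"
  by (simp add: In_def)

lemma at2_simps [simp]:
  "reg (at2 s u w) 0 = Vtx u" "reg (at2 s u w) 1 = Vtx w" "reg (at2 s u w) (Suc 0) = Vtx w"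
  "x > 1 \<Longrightarrow> reg (at2 s u w) x = reg s x"
  "dct (at2 s u w) = dct s" "mem R (at2 s u w) d = mem R s d" "vmem R (at2 s u w) d k = vmem R s d k"
  by (auto simp: at2_def mem_def vmem_def)

lemma mem_reg_update [simp]: "mem R (s\<lparr>reg := f\<rparr>) d = mem R s d"
  by (simp add: mem_def)

abbreviation X :: exp where "X \<equiv> Reg 0"
abbreviation Y :: exp where "Y \<equiv> Reg 1"

text \<open>Deleted vertices are recorded rather than present ones, so that in the initial state
  every vertex is present.\<close>

definition alive :: "exp \<Rightarrow> bexp" where
  "alive e = Neg (In 1 e)"

lemma alive_simps [simp]:
  "eval_bexp R s (alive e) \<longleftrightarrow> \<not> vmem R s 1 (eval_exp s e)"
  "dicts (alive e) = insert 1 (exp_dicts e)" "regs (alive e) = exp_regs e"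
  by (auto simp: alive_def)

text \<open>Membership in \<open>rest E A v\<close>, for \<open>v\<close> in register 3.\<close>

definition residual :: "exp \<Rightarrow> bexp" where
  "residual e = Conj (alive e) (Conj (Neg (Eq e (Reg 3))) (Neg (InMem (Reg 3) e)))"

lemma residual_simps [simp]:
  "eval_bexp R s (residual e) \<longleftrightarrow> \<not> vmem R s 1 (eval_exp s e) \<and> eval_exp s e \<noteq> reg s 3
     \<and> \<not> vedge R (reg s 3) (eval_exp s e)"
  "dicts (residual e) = insert 1 (exp_dicts e)"
  by (auto simp: residual_def)

text \<open>Dictionary 0 holds \<open>K\<close>, dictionary 1 the deleted vertices and dictionary 2 the stack, an array whose
  length is in register 8. The remaining dictionaries are temporary vertex sets.\<close>

text \<open>The program cannot compute with the real number \<open>t\<close>; it selects a vertex maximizing the ratio of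
  gain to loss, which satisfies the hypothesis if any vertex does. Gain and loss of the vertex in
  register 3 are in dictionaries 4 and 5, those of the best vertex so far, kept in register 5,
  in dictionaries 6 and 7. The ratios are cross-multiplied by counting pairs of vertices. The
  initial values \<open>{}\<close> and \<open>V\<close> of dictionaries 6 and 7 stand for the ratio 0.\<close>

definition candidate :: com where
  "candidate =
    Seq (Collect_in 3 (Conj (residual Y) (InMem Y X)))
   (Seq (Collect_in 9 (Conj (residual X) (Neg (In 3 X))))
   (Seq (Collect_in 4 (Conj (alive X) (Or (InMem (Reg 3) X) (Conj (In 9 Y) (InMem Y X)))))
   (Seq (Collect_in 3 (Conj (In 9 Y) (InMem Y (Reg 3))))
   (Seq (Collect_in 5 (Or (In 9 X) (Conj (Eq X (Reg 3)) (Neg (In 3 X)))))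
   (Seq (Count 6 (Conj (In 4 X) (In 7 Y)))
   (Seq (Count 7 (Conj (In 6 X) (In 5 Y)))
   (Cond (Less (Reg 7) (Reg 6))
     (Seq (Collect_in 6 (In 4 X)) (Seq (Collect_in 7 (In 5 X)) (Assign 5 (Reg 3)))) Skip)))))))"

text \<open>A vertex is put aside only if the count in register 6 shows no source. The number 0 in
  register 5 means that none has been found, as happens when no vertex is left.\<close>

definition pick :: com where
  "pick =
    Seq (Collect_in 3 (Conj (alive Y) (InMem Y X)))
   (Seq (Count 6 (Conj (alive X) (Neg (In 3 X))))
   (Cond (Eq (Reg 6) (Const 0))
     (Seq (Assign 5 (Const 0))
     (Seq (Clear 6)
     (Seq (Collect_in 7 (Eq X X))
     (Seq (For 3 Keys (Cond (alive (Reg 3)) candidate Skip))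
     (Cond (Eq (Reg 5) (Const 0)) Skip
       (Seq (Store 2 (Reg 8) (Reg 5))
       (Seq (Assign 8 (Inc (Reg 8)))
       (Add 1 (Or (Eq X (Reg 5)) (InMem (Reg 5) X))))))))))
     Skip))"

text \<open>Dictionary 7 serves as a truth value, all vertices or none: whether the vertex in
  register 4 is needed.\<close>

definition prune :: com where
  "prune =
    Seq (Collect_in 6 (Conj (alive Y) (Conj (Neg (Eq Y (Reg 4))) (InMem Y X))))
   (Seq (Collect_in 7 (Conj (alive Y) (Conj (Neg (In 5 Y)) (Conj (InMem (Reg 4) Y) (Neg (In 6 Y))))))
   (Add 1 (Conj (Eq X (Reg 4)) (Conj (In 5 X) (Neg (In 7 X))))))"

text \<open>Dictionary 9 holds the sources, 4 their out-neighbours and 5 the out-neighbours of the latter.\<close>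

definition reduce :: com where
  "reduce =
    Seq (Collect_in 3 (Conj (alive Y) (InMem Y X)))
   (Seq (Collect_in 9 (Conj (alive X) (Neg (In 3 X))))
   (Seq (Collect_in 4 (Conj (alive X) (Conj (In 9 Y) (InMem Y X))))
   (Seq (Collect_in 5 (Conj (In 4 Y) (InMem Y X)))
   (Seq (Add 0 (In 9 X))
   (Seq (Add 1 (Or (In 9 X) (In 4 X)))
   (For 4 Keys prune))))))"

text \<open>One absorption of \<open>unwind\<close>; dictionary 3 is the truth value of its
  test.\<close>

definition pop :: com where
  "pop =
    Seq (Assign 8 (Dec (Reg 8)))
   (Seq (Assign 3 (Look 2 (Reg 8)))
   (Seq (Collect_in 3 (Conj (In 0 Y) (InMem Y (Reg 3))))
   (Add 0 (Conj (Eq X (Reg 3)) (Neg (In 3 X))))))"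

text \<open>Register 2 is only a counter. Each round deletes a vertex as long as there is one and
  puts at most one aside, so \<open>n\<close> repetitions suffice for both loops.\<close>

definition small_quasi_kernel :: com where
  "small_quasi_kernel =
    Seq (For 2 Keys (Seq pick reduce))
   (For 2 Keys (Cond (Less (Const 0) (Reg 8)) pop Skip))"

text \<open>The depth counts the rounds, the loop over candidates or over vertices to be pruned, and
  the two loops over pairs.\<close>

lemma small_quasi_kernel_loops:
  "for_keys_only small_quasi_kernel" "depth small_quasi_kernel = 4"
  by (simp_all add: small_quasi_kernel_def pick_def reduce_def pop_def prune_def candidate_def
      Collect_in_def Count_def Add_def Clear_def For_pairs_def)

section \<open>Correctness of the program\<close>

text \<open>Symbolic execution: after stage \<open>i\<close>, the facts \<open>mi\<close>,
  \<open>ri\<close> and \<open>di\<close> describe the vertex sets, the registers above 1 and the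
  raw dictionaries. \<open>better\<close> compares the ratios of gain to loss.\<close>

lemma sem_candidate:
  assumes dist: "distinct (keys R)" and v: "reg s 3 = Vtx v" "v \<in> set (keys R)"
  defines "E \<equiv> edge R" and "A \<equiv> set (keys R) - mem R s 1" and "s' \<equiv> sem R candidate s"
  defines "better \<equiv> card (mem R s 6) * card (loss E A v) < card (gain E A v) * card (mem R s 7)"
  shows "mem R s' 6 = (if better then gain E A v else mem R s 6)"
    and "mem R s' 7 = (if better then loss E A v else mem R s 7)"
    and "reg s' 5 = (if better then Vtx v else reg s 5)"
    and "mem R s' 1 = mem R s 1" "dct s' 0 = dct s 0" "dct s' 2 = dct s 2"
    and "reg s' 8 = reg s 8"
proof -
  note Collect = sem_Collect_in[OF dist] and Count = sem_Count[OF dist]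
  let ?V = "set (keys R)"
  define s1 where "s1 = sem R (Collect_in 3 (Conj (residual Y) (InMem Y X))) s"
  define s2 where "s2 = sem R (Collect_in 9 (Conj (residual X) (Neg (In 3 X)))) s1"
  define s3 where "s3 = sem R (Collect_in 4 (Conj (alive X) (Or (InMem (Reg 3) X) (Conj (In 9 Y) (InMem Y X))))) s2"
  define s4 where "s4 = sem R (Collect_in 3 (Conj (In 9 Y) (InMem Y (Reg 3)))) s3"
  define s5 where "s5 = sem R (Collect_in 5 (Or (In 9 X) (Conj (Eq X (Reg 3)) (Neg (In 3 X))))) s4"
  define s6 where "s6 = sem R (Count 6 (Conj (In 4 X) (In 7 Y))) s5"
  define s7 where "s7 = sem R (Count 7 (Conj (In 6 X) (In 5 Y))) s6"
  define S where "S = src E (rest E A v)"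
  have S_sub: "S \<subseteq> A" by (auto simp: S_def src_def rest_def)
  have gain: "gain E A v = {u \<in> A. E v u \<or> (\<exists>q\<in>S. E q u)}"
    by (auto simp: gain_def nbrs_def S_def)
  have loss: "loss E A v = absorb E v S" by (simp add: loss_def S_def)
  have A_sub: "A \<subseteq> ?V" and A_iff: "u \<in> ?V \<Longrightarrow> u \<in> mem R s (Suc 0) \<longleftrightarrow> u \<notin> A"
    and E_eq: "edge R = E" and A_in: "u \<in> A \<Longrightarrow> u \<in> ?V" for u by (auto simp: A_def E_def)
  have S_in: "u \<in> S \<Longrightarrow> u \<in> ?V" for u using S_sub A_sub by auto
  have m1: "mem R s1 d = (if d = 3 then {u \<in> ?V. \<exists>w\<in>rest E A v. E w u} else mem R s d)" for d
    using A_sub by (auto simp: s1_def Collect v A_iff A_in S_in E_eq rest_def)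
  have r1: "reg s1 x = reg s x" if "x > 1" for x using that by (simp add: s1_def Collect)
  have d1: "dct s1 d = dct s d" if "d \<in> {0, 2}" for d using that by (auto simp: s1_def Collect)
  have m2: "mem R s2 d = (if d = 9 then S else mem R s1 d)" for d
    using v A_sub by (auto simp: s2_def Collect v m1 r1 S_def src_def A_iff A_in S_in E_eq rest_def)
  have r2: "reg s2 x = reg s x" if "x > 1" for x using that by (simp add: s2_def Collect r1)
  have d2: "dct s2 d = dct s d" if "d \<in> {0, 2}" for d using that by (auto simp: s2_def Collect d1)
  have m3: "mem R s3 d = (if d = 4 then gain E A v else mem R s2 d)" for d
    using S_sub v A_sub by (auto simp: s3_def Collect m1 m2 r2 gain A_iff A_in S_in E_eq)
  have r3: "reg s3 x = reg s x" if "x > 1" for x using that by (simp add: s3_def Collect r2)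
  have d3: "dct s3 d = dct s d" if "d \<in> {0, 2}" for d using that by (auto simp: s3_def Collect d2)
  \<comment> \<open>Register 0 does not occur in this test, so dictionary 3 now holds a truth
    value.\<close>
  have m4: "mem R s4 d = (if d = 3 then if \<exists>q\<in>S. E q v then ?V else {} else mem R s3 d)" for d
    using S_sub v A_sub by (auto simp: s4_def Collect m1 m2 m3 r3 A_iff A_in S_in E_eq)
  have r4: "reg s4 x = reg s x" if "x > 1" for x using that by (simp add: s4_def Collect r3)
  have d4: "dct s4 d = dct s d" if "d \<in> {0, 2}" for d using that by (auto simp: s4_def Collect d3)
  have m5: "mem R s5 d = (if d = 5 then loss E A v else mem R s4 d)" for d
    using S_sub v A_sub by (auto simp: s5_def Collect m1 m2 m3 m4 r4 A_iff A_in S_in E_eq loss absorb_def split: if_splits)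
  have r5: "reg s5 x = reg s x" if "x > 1" for x using that by (simp add: s5_def Collect r4)
  have d5: "dct s5 d = dct s d" if "d \<in> {0, 2}" for d using that by (auto simp: s5_def Collect d4)
  have sub: "gain E A v \<subseteq> ?V" "loss E A v \<subseteq> ?V" "mem R s d \<subseteq> ?V" for d
    using v by (auto simp: gain_def loss_def nbrs_def A_def absorb_def src_def rest_def mem_def)
  have prod: "{(u, w). (u, w) \<in> ?V \<times> ?V \<and> u \<in> M \<and> w \<in> N} = M \<times> N" if "M \<subseteq> ?V" "N \<subseteq> ?V" for M N
    using that by auto
  have r6: "reg s6 x = (if x = 6 then Num (card (gain E A v) * card (mem R s 7)) else reg s x)"
    if "x > 1" for x
    using that prod[OF sub(1,3)] by (auto simp: s6_def Count r5 m5 m4 m3 m2 m1 card_cartesian_product conj_commute cong: conj_cong)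
  have d6: "dct s6 = dct s5" by (simp add: s6_def Count)
  have m6: "mem R s6 d = mem R s5 d" for d by (simp add: mem_def d6)
  have r7: "reg s7 x = (if x = 7 then Num (card (mem R s 6) * card (loss E A v)) else reg s6 x)"
    if "x > 1" for x
    using that prod[OF sub(3,2)] by (auto simp: s7_def Count m6 m5 m4 m3 m2 m1 card_cartesian_product cong: conj_cong)
  have d7: "dct s7 = dct s5" by (simp add: s7_def Count d6)
  have m7: "mem R s7 d = mem R s5 d" for d by (simp add: mem_def d7)
  have s': "s' = (if better then sem R (Seq (Collect_in 6 (In 4 X)) (Seq (Collect_in 7 (In 5 X)) (Assign 5 (Reg 3)))) s7 else s7)"
    unfolding s'_def candidate_def sem.simps s1_def[symmetric] s2_def[symmetric] s3_def[symmetric]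
      s4_def[symmetric] s5_def[symmetric] s6_def[symmetric] s7_def[symmetric]
    by (simp add: r7 r6 m6 m5 m4 m3 m2 m1 better_def)
  \<comment> \<open>The last two sets are copied by tests without register 1, over which
    \<open>Collect_in\<close> still quantifies.\<close>
  have ne: "?V \<noteq> {}" using v by auto
  show "mem R s' 6 = (if better then gain E A v else mem R s 6)"
    "mem R s' 7 = (if better then loss E A v else mem R s 7)"
    "reg s' 5 = (if better then Vtx v else reg s 5)"
    "mem R s' 1 = mem R s 1" "dct s' 0 = dct s 0" "dct s' 2 = dct s 2" "reg s' 8 = reg s 8"
    using ne sub by (auto simp: s' Collect m7 m5 m4 m3 m2 m1 r7 r6 d7 d5 v)
qed

section \<open>Choice of a vertex with the best ratio\<close>

text \<open>If \<open>absorb\<close> leaves \<open>v\<close> out, it contains a vertex with an edge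
  to \<open>v\<close>. Thus the denominators of the ratios are positive.\<close>

lemma card_loss_pos: "finite A \<Longrightarrow> card (loss E A v) > 0"
  by (auto simp: card_gt_0_iff loss_def absorb_def src_def rest_def)

text \<open>This is \<open>a/b \<le> g/l < c/d\<close> with denominators cleared; strictness makes
  \<open>l\<close> positive, so that it can be cancelled.\<close>

lemma better_trans:
  fixes a b c d g l :: nat
  assumes "a * l \<le> g * b" "g * d < c * l"
  shows "a * d \<le> c * b"
proof -
  have "l > 0" using assms(2) by (cases l) auto
  have "a * d * l \<le> g * d * b" using assms(1) mult_right_mono[of "a * l" "g * b" d]
    by (simp add: ac_simps)
  also have "\<dots> \<le> c * l * b" using assms(2) by (intro mult_right_mono) auto
  finally have "(a * d) * l \<le> (c * b) * l" by (simp add: ac_simps)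
  then show ?thesis using \<open>l > 0\<close> by simp
qed

lemma sem_pick:
  fixes t :: real and s :: "'a state"
  assumes dist: "distinct (keys R)"
  defines "E \<equiv> edge R" and "A \<equiv> set (keys R) - mem R s 1" and "s' \<equiv> sem R pick s"
  assumes ex: "A \<noteq> {} \<Longrightarrow> src E A = {} \<Longrightarrow>
    \<exists>v\<in>A. real (card (loss E A v)) \<le> t * real (card (gain E A v))"
  shows "dct s' 0 = dct s 0"
    and "mem R s' 1 = mem R s 1 \<and> (A = {} \<or> src E A \<noteq> {}) \<and> dct s' 2 = dct s 2 \<and> reg s' 8 = reg s 8 \<or>
      (\<exists>v\<in>A. real (card (loss E A v)) \<le> t * real (card (gain E A v)) \<and>
        set (keys R) - mem R s' 1 = rest E A v \<and>
        dct s' 2 = (dct s 2)(reg s 8 := Vtx v) \<and> reg s' 8 = val_inc (reg s 8))"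
proof -
  note Collect = sem_Collect_in[OF dist] and Count = sem_Count[OF dist]
    and Clear = sem_Clear[OF dist] and Add = sem_Add[OF dist] mem_Add[OF dist]
  let ?V = "set (keys R)"
  define s1 where "s1 = sem R (Collect_in 3 (Conj (alive Y) (InMem Y X))) s"
  define s2 where "s2 = sem R (Count 6 (Conj (alive X) (Neg (In 3 X)))) s1"
  define s3 where "s3 = sem R (Collect_in 7 (Eq X X)) (sem R (Clear 6) (sem R (Assign 5 (Const 0)) s2))"
  define s4 where "s4 = sem R (For 3 Keys (Cond (alive (Reg 3)) candidate Skip)) s3"
  have A_iff: "u \<in> ?V \<Longrightarrow> u \<in> mem R s (Suc 0) \<longleftrightarrow> u \<notin> A"
    and E_eq: "edge R = E" and A_in: "u \<in> A \<Longrightarrow> u \<in> ?V" for u by (auto simp: A_def E_def)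
  have fin: "finite A" by (simp add: A_def)
  have m1: "mem R s1 d = (if d = 3 then {u \<in> ?V. \<exists>w\<in>A. E w u} else mem R s d)" for d
    by (auto simp: s1_def Collect A_iff A_in E_eq)
  have r1: "reg s1 x = reg s x" if "x > 1" for x using that by (simp add: s1_def Collect)
  have d1: "dct s1 d = dct s d" if "d \<in> {0, 2}" for d using that by (auto simp: s1_def Collect)
  \<comment> \<open>Register 1 is free in the test, so each source is counted once per key.\<close>
  have "{(u, w) \<in> ?V \<times> ?V. eval_bexp R (at2 s1 u w) (Conj (alive X) (Neg (In 3 X)))} = src E A \<times> ?V"
    by (auto simp: m1 src_def A_in A_iff)
  then have r2: "reg s2 x = (if x = 6 then Num (card (src E A) * card ?V) else reg s x)" if "x > 1" for x
    using that by (simp add: s2_def Count r1 card_cartesian_product)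
  have d2: "dct s2 = dct s1" by (simp add: s2_def Count)
  have m2: "mem R s2 d = mem R s1 d" for d by (simp add: mem_def d2)
  have "card (src E A) * card ?V = 0 \<longleftrightarrow> A = {} \<or> src E A = {}"
    using fin by (auto simp: A_def src_def)
  then have s': "s' = (if A = {} \<or> src E A = {} then
      if reg s4 5 = Num 0 then s4 else sem R (Add 1 (Or (Eq X (Reg 5)) (InMem (Reg 5) X)))
        (sem R (Seq (Store 2 (Reg 8) (Reg 5)) (Assign 8 (Inc (Reg 8)))) s4)
      else s2)"
    unfolding s'_def pick_def sem.simps(1,4,5) s1_def[symmetric] s2_def[symmetric]
      s3_def[symmetric] s4_def[symmetric] by (simp add: r2)
  have m3: "mem R s3 d = (if d = 6 then {} else if d = 7 then ?V else mem R s2 d)" for d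
    using Clear by (auto simp: s3_def Collect) (auto simp: mem_def)
  have r3: "reg s3 x = (if x = 5 then Num 0 else reg s2 x)" if "x > 1" for x
    using that by (simp add: s3_def Collect Clear)
  have d3: "dct s3 d = dct s d" if "d \<in> {0, 2}" for d using that by (auto simp: s3_def Collect Clear d2 d1)
  \<comment> \<open>Dictionaries 6 and 7 hold the best ratio among the present vertices visited so
    far, at first 0.\<close>
  define J where "J Z s' \<longleftrightarrow> mem R s' 1 = mem R s 1 \<and> dct s' 0 = dct s 0 \<and> dct s' 2 = dct s 2 \<and>
      reg s' 8 = reg s 8 \<and>
      (reg s' 5 = Num 0 \<and> mem R s' 6 = {} \<or>
        (\<exists>v\<in>A. reg s' 5 = Vtx v \<and> mem R s' 6 = gain E A v \<and> mem R s' 7 = loss E A v)) \<and>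
      card (mem R s' 7) > 0 \<and>
      (\<forall>u\<in>Z \<inter> A. card (gain E A u) * card (mem R s' 7) \<le> card (mem R s' 6) * card (loss E A u))"
    for Z and s' :: "'a state"
  have J: "J ?V s4" if "A \<noteq> {}"
    unfolding s4_def
  proof (rule sem_For_keys[where Inv = J, OF dist])
    have "?V \<noteq> {}" using that by (auto simp: A_def)
    then show "J {} s3" by (auto simp: J_def m3 m2 m1 d3 r3 r2 card_gt_0_iff)
    fix Z v and p :: "'a state"
    assume v: "v \<in> ?V" and I: "J Z p"
    let ?p = "p\<lparr>reg := (reg p)(3 := Vtx v)\<rparr>"
    have mem1: "mem R p 1 = mem R s 1" using I by (simp add: J_def)
    have cond: "eval_bexp R ?p (alive (Reg 3)) \<longleftrightarrow> v \<in> A"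
      using v by (simp add: mem1[simplified] A_iff)
    show "J (insert v Z) (sem R (Cond (alive (Reg 3)) candidate Skip) ?p)"
    proof (cases "v \<in> A")
      case False
      then have "sem R (Cond (alive (Reg 3)) candidate Skip) ?p = ?p" using cond by simp
      then show ?thesis using I False by (auto simp: J_def)
    next
      case True
      let ?q = "sem R candidate ?p"
      have q: "sem R (Cond (alive (Reg 3)) candidate Skip) ?p = ?q" using cond True by simp
      define better where "better \<longleftrightarrow> card (mem R p 6) * card (loss E A v) < card (gain E A v) * card (mem R p 7)"
      have A: "set (keys R) - mem R ?p 1 = A" by (simp add: mem1[simplified] A_def)
      note cand = sem_candidate[OF dist, of ?p v, folded E_def, unfolded A, simplified, OF v, folded better_def]
      show ?thesis
      proof (cases better)
        case True
        have "card (gain E A u) * card (loss E A v) \<le> card (gain E A v) * card (loss E A u)"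
          if "u \<in> insert v Z \<inter> A" for u
          using that I better_trans[of "card (gain E A u)" "card (mem R p 7)" "card (mem R p 6)"
              "card (loss E A u)" "card (loss E A v)" "card (gain E A v)"] True
          by (auto simp: J_def better_def)
        then show ?thesis unfolding q J_def
          using cand I True \<open>v \<in> A\<close> card_loss_pos[OF fin] by (auto simp: J_def)
      next
        case False
        then show ?thesis unfolding q J_def
          using cand I by (auto simp: J_def better_def not_less)
      qed
    qed
  qed
  have best: "\<exists>v\<in>A. reg s4 5 = Vtx v \<and> real (card (loss E A v)) \<le> t * real (card (gain E A v))"
    if nonempty: "A \<noteq> {}" and no_src: "src E A = {}"
  proof -
    note J = J[OF nonempty, unfolded J_def]
    obtain v where v: "v \<in> A" "real (card (loss E A v)) \<le> t * real (card (gain E A v))"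
      using ex[OF nonempty no_src] by blast
    have pos: "card (loss E A v) > 0" using card_loss_pos[OF fin] .
    \<comment> \<open>A positive loss forces a positive gain, which rules out that the ratio is
      still the initial 0.\<close>
    then have g: "card (gain E A v) > 0" using v(2) by (cases "card (gain E A v)") auto
    have le: "card (gain E A v) * card (mem R s4 7) \<le> card (mem R s4 6) * card (loss E A v)"
      using J v(1) A_in by blast
    moreover have "card (gain E A v) * card (mem R s4 7) > 0" using g J by simp
    ultimately have "mem R s4 6 \<noteq> {}" by (metis card.empty less_le_not_le mult_0)
    then obtain b where b: "b \<in> A" "reg s4 5 = Vtx b" "mem R s4 6 = gain E A b" "mem R s4 7 = loss E A b"
      using J by blast
    have "real (card (gain E A v)) * real (card (loss E A b)) \<le> real (card (gain E A b)) * real (card (loss E A v))"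
      using le unfolding b by (metis of_nat_le_iff of_nat_mult)
    also have "\<dots> \<le> real (card (gain E A b)) * (t * real (card (gain E A v)))"
      using v(2) by (intro mult_left_mono) auto
    finally have "real (card (gain E A v)) * real (card (loss E A b))
        \<le> real (card (gain E A v)) * (t * real (card (gain E A b)))" by (simp add: ac_simps)
    then show ?thesis using g b by auto
  qed
  consider "A = {}" | "A \<noteq> {}" "src E A \<noteq> {}" | "A \<noteq> {}" "src E A = {}" by blast
  then have "dct s' 0 = dct s 0 \<and> (mem R s' 1 = mem R s 1 \<and> (A = {} \<or> src E A \<noteq> {}) \<and> dct s' 2 = dct s 2 \<and> reg s' 8 = reg s 8 \<or>
      (\<exists>v\<in>A. real (card (loss E A v)) \<le> t * real (card (gain E A v)) \<and>
        set (keys R) - mem R s' 1 = rest E A v \<and>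
        dct s' 2 = (dct s 2)(reg s 8 := Vtx v) \<and> reg s' 8 = val_inc (reg s 8)))"
  proof cases
    case 1
    \<comment> \<open>\<open>J\<close> asks for a nonempty dictionary 7, which fails if there are no
      keys; here it is enough that register 5 stays 0.\<close>
    define J' where "J' s' \<longleftrightarrow> mem R s' 1 = mem R s 1 \<and> dct s' 0 = dct s 0 \<and> dct s' 2 = dct s 2 \<and>
      reg s' 8 = reg s 8 \<and> reg s' 5 = Num 0" for s' :: "'a state"
    have "J' s4"
      unfolding s4_def
    proof (rule sem_For_keys[where Inv = "\<lambda>_. J'", OF dist])
      show "J' s3" by (auto simp: J'_def m3 m2 m1 d3 r3 r2)
      fix v and p :: "'a state" assume "v \<in> ?V" "J' p"
      then show "J' (sem R (Cond (alive (Reg 3)) candidate Skip) (p\<lparr>reg := (reg p)(3 := Vtx v)\<rparr>))"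
        using A_iff[of v] 1 by (auto simp: J'_def)
    qed
    then show ?thesis using 1 by (simp add: s' J'_def)
  next
    case 2
    then show ?thesis by (simp add: s' m2 m1 d2 d1 r2)
  next
    case 3
    obtain v where v: "v \<in> A" "reg s4 5 = Vtx v" "real (card (loss E A v)) \<le> t * real (card (gain E A v))"
      using best 3 by blast
    note J = J[OF 3(1), unfolded J_def]
    define p where "p = sem R (Seq (Store 2 (Reg 8) (Reg 5)) (Assign 8 (Inc (Reg 8)))) s4"
    have s': "s' = sem R (Add 1 (Or (Eq X (Reg 5)) (InMem (Reg 5) X))) p"
      using 3 v(2) by (simp add: s' p_def)
    have p: "dct p 0 = dct s 0" "dct p 2 = (dct s 2)(reg s 8 := Vtx v)" "reg p 8 = val_inc (reg s 8)"
      "mem R p 1 = mem R s 1" "reg p 5 = Vtx v"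
      using J v by (auto simp: p_def mem_def)
    have "set (keys R) - mem R s' 1 = rest E A v"
      using v(1) p by (auto simp: s' Add rest_def A_in A_iff E_eq)
    moreover have "dct s' 0 = dct s 0" "dct s' 2 = (dct s 2)(reg s 8 := Vtx v)" "reg s' 8 = val_inc (reg s 8)"
      using p by (simp_all add: s' Add)
    ultimately show ?thesis using v by blast
  qed
  then show "dct s' 0 = dct s 0"
    "mem R s' 1 = mem R s 1 \<and> (A = {} \<or> src E A \<noteq> {}) \<and> dct s' 2 = dct s 2 \<and> reg s' 8 = reg s 8 \<or>
      (\<exists>v\<in>A. real (card (loss E A v)) \<le> t * real (card (gain E A v)) \<and>
        set (keys R) - mem R s' 1 = rest E A v \<and>
        dct s' 2 = (dct s 2)(reg s 8 := Vtx v) \<and> reg s' 8 = val_inc (reg s 8))" by blast+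
qed

section \<open>Deleting the unneeded vertices\<close>

text \<open>A needed vertex stays needed: its witness lies outside \<open>W\<close> and is not
  deleted, and in-neighbours only get fewer. Hence a single pass reaches a maximal deletion.\<close>

lemma prune_step:
  assumes "A' = (if w \<in> W \<and> \<not> needed E W A w then A - {w} else A)"
    and "src E A \<subseteq> W" "\<forall>x\<in>Z \<inter> A \<inter> W. needed E W A x"
  shows "src E A' \<subseteq> W" "\<forall>x\<in>insert w Z \<inter> A' \<inter> W. needed E W A' x"
proof -
  show "src E A' \<subseteq> W"
  proof
    fix u assume u: "u \<in> src E A'"
    show "u \<in> W"
    proof (rule ccontr)
      assume "u \<notin> W"
      then obtain y where "y \<in> A" "E y u" "u \<in> A" using u assms(1,2) by (auto simp: src_def split: if_splits)
      then have "w \<in> W \<and> \<not> needed E W A w \<and> (\<forall>y\<in>A. E y u \<longrightarrow> y = w)"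
        using u assms(1) by (auto simp: src_def split: if_splits)
      then show False using \<open>y \<in> A\<close> \<open>E y u\<close> \<open>u \<in> A\<close> \<open>u \<notin> W\<close> unfolding needed_def by blast
    qed
  qed
  show "\<forall>x\<in>insert w Z \<inter> A' \<inter> W. needed E W A' x"
    using assms(1,3) unfolding needed_def by (auto split: if_splits) blast
qed

lemma sem_prune:
  assumes dist: "distinct (keys R)" and w: "reg s 4 = Vtx w" "w \<in> set (keys R)"
  defines "A \<equiv> set (keys R) - mem R s 1" and "s' \<equiv> sem R prune s"
  shows "set (keys R) - mem R s' 1 =
      (if w \<in> mem R s 5 \<and> \<not> needed (edge R) (mem R s 5) A w then A - {w} else A)"
    and "mem R s' 5 = mem R s 5" "dct s' 0 = dct s 0" "dct s' 2 = dct s 2" "reg s' 8 = reg s 8"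
proof -
  note Collect = sem_Collect_in[OF dist] and Add = sem_Add[OF dist] mem_Add[OF dist]
  let ?V = "set (keys R)" and ?E = "edge R" and ?W = "mem R s 5"
  define s1 where "s1 = sem R (Collect_in 6 (Conj (alive Y) (Conj (Neg (Eq Y (Reg 4))) (InMem Y X)))) s"
  define s2 where "s2 = sem R (Collect_in 7 (Conj (alive Y) (Conj (Neg (In 5 Y)) (Conj (InMem (Reg 4) Y) (Neg (In 6 Y)))))) s1"
  have A_iff: "u \<in> ?V \<Longrightarrow> u \<in> mem R s (Suc 0) \<longleftrightarrow> u \<notin> A"
    and A_in: "u \<in> A \<Longrightarrow> u \<in> ?V" for u by (auto simp: A_def)
  have m1: "mem R s1 d = (if d = 6 then {u \<in> ?V. \<exists>y\<in>A. y \<noteq> w \<and> ?E y u} else mem R s d)" for d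
    by (auto simp: s1_def Collect w A_iff A_in)
  have r1: "reg s1 x = reg s x" if "x > 1" for x using that by (simp add: s1_def Collect)
  have d1: "dct s1 d = dct s d" if "d \<in> {0, 2}" for d using that by (auto simp: s1_def Collect)
  have m2: "mem R s2 d = (if d = 7 then if needed ?E ?W A w then ?V else {} else mem R s1 d)" for d
    by (auto simp: s2_def Collect w m1 r1 A_iff A_in needed_def)
  have r2: "reg s2 x = reg s x" if "x > 1" for x using that by (simp add: s2_def Collect r1)
  have d2: "dct s2 d = dct s d" if "d \<in> {0, 2}" for d using that by (auto simp: s2_def Collect d1)
  have s': "s' = sem R (Add 1 (Conj (Eq X (Reg 4)) (Conj (In 5 X) (Neg (In 7 X))))) s2"
    unfolding s'_def prune_def sem.simps(4) s1_def s2_def ..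
  show "?V - mem R s' 1 = (if w \<in> ?W \<and> \<not> needed ?E ?W A w then A - {w} else A)"
    using w by (auto simp: s' Add m2 m1 r2 A_iff A_in split: if_splits)
  show "mem R s' 5 = mem R s 5" "dct s' 0 = dct s 0" "dct s' 2 = dct s 2" "reg s' 8 = reg s 8"
    by (simp_all add: s' Add m2 m1 d2 r2)
qed

text \<open>The program's set of second out-neighbours may exceed \<open>covered E A\<close> by
  vertices outside the core, which are absent during pruning.\<close>

lemma needed_cong: "A - W = A - W' \<Longrightarrow> needed E W A w = needed E W' A w"
  by (simp add: needed_def)

text \<open>Dictionary 0 is described at all values and not just through \<open>mem\<close>, because
  \<open>returned\<close> ranges over every vertex of the type.\<close>

lemma sem_reduce:
  fixes s :: "'a state"
  assumes dist: "distinct (keys R)"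
  defines "E \<equiv> edge R" and "A \<equiv> set (keys R) - mem R s 1" and "s' \<equiv> sem R reduce s"
  shows "pruned E A (set (keys R) - mem R s' 1)"
    and "dct s' 0 = (\<lambda>k. if k \<in> Vtx ` src E A then Num 1 else dct s 0 k)"
    and "dct s' 2 = dct s 2" "reg s' 8 = reg s 8"
proof -
  note Collect = sem_Collect_in[OF dist] and Add = sem_Add[OF dist] mem_Add[OF dist]
  let ?V = "set (keys R)"
  define s1 where "s1 = sem R (Collect_in 3 (Conj (alive Y) (InMem Y X))) s"
  define s2 where "s2 = sem R (Collect_in 9 (Conj (alive X) (Neg (In 3 X)))) s1"
  define s3 where "s3 = sem R (Collect_in 4 (Conj (alive X) (Conj (In 9 Y) (InMem Y X)))) s2"
  define s4 where "s4 = sem R (Collect_in 5 (Conj (In 4 Y) (InMem Y X))) s3"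
  define s5 where "s5 = sem R (Add 0 (In 9 X)) s4"
  define s6 where "s6 = sem R (Add 1 (Or (In 9 X) (In 4 X))) s5"
  define S where "S = src E A"
  define N where "N = nbrs E A S"
  define W where "W = covered E A"
  have A_iff: "u \<in> ?V \<Longrightarrow> u \<in> mem R s (Suc 0) \<longleftrightarrow> u \<notin> A"
    and E_eq: "edge R = E" and A_in: "u \<in> A \<Longrightarrow> u \<in> ?V" for u by (auto simp: A_def E_def)
  have S_sub: "S \<subseteq> A" and N_sub: "N \<subseteq> A" by (auto simp: S_def N_def src_def nbrs_def)
  then have S_in: "u \<in> S \<Longrightarrow> u \<in> ?V" and N_in: "u \<in> N \<Longrightarrow> u \<in> ?V" for u using A_in by auto
  have m1: "mem R s1 d = (if d = 3 then {u \<in> ?V. \<exists>w\<in>A. E w u} else mem R s d)" for d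
    by (auto simp: s1_def Collect A_iff A_in E_eq)
  have r1: "reg s1 x = reg s x" if "x > 1" for x using that by (simp add: s1_def Collect)
  have d1: "dct s1 d = dct s d" if "d \<in> {0, 2}" for d using that by (auto simp: s1_def Collect)
  have m2: "mem R s2 d = (if d = 9 then S else mem R s1 d)" for d
    by (auto simp: s2_def Collect m1 A_iff A_in E_eq S_def src_def intro: A_in)
  have r2: "reg s2 x = reg s x" if "x > 1" for x using that by (simp add: s2_def Collect r1)
  have d2: "dct s2 d = dct s d" if "d \<in> {0, 2}" for d using that by (auto simp: s2_def Collect d1)
  have m3: "mem R s3 d = (if d = 4 then N else mem R s2 d)" for d
    using S_sub by (auto simp: s3_def Collect m2 m1 A_iff A_in S_in E_eq N_def nbrs_def)
  have r3: "reg s3 x = reg s x" if "x > 1" for x using that by (simp add: s3_def Collect r2)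
  have d3: "dct s3 d = dct s d" if "d \<in> {0, 2}" for d using that by (auto simp: s3_def Collect d2)
  have m4: "mem R s4 d = (if d = 5 then nbrs E ?V N else mem R s3 d)" for d
    by (auto simp: s4_def Collect m3 N_in E_eq nbrs_def)
  have r4: "reg s4 x = reg s x" if "x > 1" for x using that by (simp add: s4_def Collect r3)
  have d4: "dct s4 d = dct s d" if "d \<in> {0, 2}" for d using that by (auto simp: s4_def Collect d3)
  have m5: "mem R s5 d = (if d = 0 then mem R s 0 \<union> S else mem R s4 d)" for d
    by (auto simp: s5_def Add m4 m3 m2 m1 S_in intro: S_in)
  have "{u \<in> ?V. \<exists>w\<in>?V. eval_bexp R (at2 s4 u w) (In 9 X)} = S"
    by (auto simp: m4 m3 m2 S_in intro: S_in)
  then have d5: "dct s5 d = (if d = 0 then (\<lambda>k. if k \<in> Vtx ` S then Num 1 else dct s 0 k) else dct s d)"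
    if "d \<in> {0, 2}" for d
    using that by (auto simp: s5_def Add d4)
  have r5: "reg s5 x = reg s x" if "x > 1" for x using that by (simp add: s5_def Add r4)
  have m6: "mem R s6 d = (if d = 1 then mem R s 1 \<union> S \<union> N else mem R s5 d)" for d
    by (auto simp: s6_def Add m5 m4 m3 m2 m1 S_in N_in intro: S_in N_in)
  have d6: "dct s6 d = dct s5 d" if "d \<in> {0, 2}" for d using that by (auto simp: s6_def Add)
  have r6: "reg s6 x = reg s x" if "x > 1" for x using that by (simp add: s6_def Add r5)
  have core: "core E A = ?V - mem R s6 1"
    by (auto simp: core_def m6 S_def N_def A_def)
  have W: "W = core E A \<inter> mem R s6 5"
    by (auto simp: W_def covered_def m6 m5 m4 N_def S_def nbrs_def core_def A_def)
  \<comment> \<open>For \<open>Z\<close> the set of all keys, the last four clauses amount to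
    \<open>pruned\<close>.\<close>
  define J where "J Z p \<longleftrightarrow> mem R p 5 = mem R s6 5 \<and> dct p 0 = dct s6 0 \<and> dct p 2 = dct s6 2 \<and>
      reg p 8 = reg s6 8 \<and> ?V - mem R p 1 \<subseteq> core E A \<and> core E A - (?V - mem R p 1) \<subseteq> W \<and>
      src E (?V - mem R p 1) \<subseteq> W \<and> (\<forall>w\<in>Z \<inter> (?V - mem R p 1) \<inter> W. needed E W (?V - mem R p 1) w)"
    for Z and p :: "'a state"
  have "J ?V (sem R (For 4 Keys prune) s6)"
  proof (rule sem_For_keys[where Inv = J, OF dist])
    show "J {} s6" unfolding J_def core[symmetric] W_def using src_core by simp
    fix Z w and p :: "'a state" assume w: "w \<in> ?V" and J: "J Z p"
    let ?p = "p\<lparr>reg := (reg p)(4 := Vtx w)\<rparr>" and ?B = "?V - mem R p 1"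
    let ?q = "sem R prune ?p" and ?W = "mem R p 5"
    note prune = sem_prune[OF dist, of ?p w, simplified, OF w]
    have B: "?B \<subseteq> core E A" and W5: "?W = mem R s6 5" using J by (auto simp: J_def)
    have "needed E ?W ?B w = needed E W ?B w"
      using B by (intro needed_cong) (auto simp: W W5)
    then have q: "?V - mem R ?q 1 = (if w \<in> W \<and> \<not> needed E W ?B w then ?B - {w} else ?B)"
      using prune(1) B by (auto simp: E_eq W W5)
    have "src E ?B \<subseteq> W" "\<forall>x\<in>Z \<inter> ?B \<inter> W. needed E W ?B x" using J by (auto simp: J_def)
    note step = prune_step[OF q this]
    have "?V - mem R ?q 1 \<subseteq> core E A" "core E A - (?V - mem R ?q 1) \<subseteq> W"
      using q J by (auto simp: J_def split: if_splits)
    then show "J (insert w Z) ?q" using step prune(2-5) J unfolding J_def by simp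
  qed
  moreover have "s' = sem R (For 4 Keys prune) s6"
    unfolding s'_def reduce_def sem.simps(4) s1_def s2_def s3_def s4_def s5_def s6_def ..
  ultimately have J: "J ?V s'" by simp
  then show "dct s' 0 = (\<lambda>k. if k \<in> Vtx ` src E A then Num 1 else dct s 0 k)"
    "dct s' 2 = dct s 2" "reg s' 8 = reg s 8"
    by (simp_all add: J_def d6 d5 r6 S_def)
  show "pruned E A (?V - mem R s' 1)"
    using J unfolding J_def pruned_def W_def by blast
qed

section \<open>Unwinding the stack and the complete run\<close>

lemma sem_pop:
  fixes s :: "'a state"
  assumes dist: "distinct (keys R)" and s: "reg s 8 = Num (Suc j)" "dct s 2 (Num j) = Vtx v"
    and v: "v \<in> set (keys R)"
  defines "s' \<equiv> sem R pop s"
  shows "mem R s' 0 = absorb (edge R) v (mem R s 0)"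
    and "k \<notin> Vtx ` set (keys R) \<Longrightarrow> dct s' 0 k = dct s 0 k"
    and "dct s' 2 = dct s 2" "reg s' 8 = Num j"
proof -
  note Collect = sem_Collect_in[OF dist] and Add = sem_Add[OF dist] mem_Add[OF dist]
  let ?V = "set (keys R)" and ?K = "mem R s 0"
  define s1 where "s1 = s\<lparr>reg := (reg s)(8 := Num j, 3 := Vtx v)\<rparr>"
  define s2 where "s2 = sem R (Collect_in 3 (Conj (In 0 Y) (InMem Y (Reg 3)))) s1"
  have s': "s' = sem R (Add 0 (Conj (Eq X (Reg 3)) (Neg (In 3 X)))) s2"
    using s by (simp add: s'_def pop_def s1_def s2_def)
  have m2: "mem R s2 d = (if d = 3 then if \<exists>q\<in>?K. edge R q v then ?V else {} else mem R s d)" for d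
    by (auto simp: s2_def s1_def Collect) (auto simp: mem_def)
  have r2: "reg s2 x = (if x = 3 then Vtx v else if x = 8 then Num j else reg s x)" if "x > 1" for x
    using that by (simp add: s2_def s1_def Collect)
  have d2: "dct s2 d = dct s d" if "d \<noteq> 3" for d using that by (auto simp: s2_def s1_def Collect)
  show "mem R s' 0 = absorb (edge R) v (mem R s 0)"
    using v by (auto simp: s' Add m2 r2 absorb_def split: if_splits)
  show "k \<notin> Vtx ` ?V \<Longrightarrow> dct s' 0 k = dct s 0 k"
    using v by (auto simp: s' Add d2 r2)
  show "dct s' 2 = dct s 2" "reg s' 8 = Num j"
    by (simp_all add: s' Add d2 r2)
qed

lemma qkernel_empty: "qkernel E {} Q \<longleftrightarrow> Q = {}"
  by (auto simp: qkernel_def nbrs_def)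

lemma sem_small_quasi_kernel:
  fixes t :: real
  assumes dist: "distinct (keys R)" and t: "t \<ge> 1"
  defines "V \<equiv> set (keys R)" and "E \<equiv> edge R"
  assumes irrefl: "\<And>v. v \<in> V \<Longrightarrow> \<not> E v v" and no_src: "src E V = {}"
    and ex: "\<And>A. \<lbrakk>A \<subseteq> V; A \<noteq> {}; src E A = {}\<rbrakk>
      \<Longrightarrow> \<exists>v\<in>A. real (card (loss E A v)) \<le> t * real (card (gain E A v))"
  defines "Q \<equiv> returned (sem R small_quasi_kernel init_state)"
  shows "qkernel E V Q" "(t + 1) * real (card Q) \<le> t * real (card V)"
proof -
  have fin: "finite V" by (simp add: V_def)
  define alv :: "'a state \<Rightarrow> 'a set" where "alv s = V - mem R s 1" for s
  define stack where "stack s vs \<longleftrightarrow> reg s 8 = Num (length vs) \<and>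
      (\<forall>j<length vs. dct s 2 (Num j) = Vtx (vs ! j))" for s :: "'a state" and vs
  define clean where "clean s \<longleftrightarrow> (\<forall>k. k \<notin> Vtx ` V \<longrightarrow> dct s 0 k = Num 0)" for s :: "'a state"
  \<comment> \<open>\<open>Z\<close> measures the rounds done: at most one vertex is stacked in
    each, and at least one is deleted until none is left.\<close>
  define J where "J Z s \<longleftrightarrow> (\<exists>vs. round_inv E V t (alv s) (mem R s 0) vs \<and> stack s vs \<and> clean s \<and>
      length vs \<le> card Z \<and> card (alv s) \<le> card V - card Z)" for Z :: "'a set" and s
  define s1 where "s1 = sem R (For 2 Keys (Seq pick reduce)) (init_state :: 'a state)"
  have "J V s1"
    unfolding s1_def
  proof (rule sem_For_keys[where Inv = J, OF dist, folded V_def])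
    have "alv init_state = V" "mem R (init_state :: 'a state) 0 = {}"
      by (auto simp: alv_def mem_def init_state_def)
    then show "J {} init_state"
      using round_inv_init[OF no_src]
      unfolding J_def by (intro exI[of _ "[]"]) (auto simp: stack_def clean_def init_state_def)
    fix Z i and s :: "'a state" assume Z: "Z \<subseteq> V" "i \<in> V" "i \<notin> Z" and "J Z s"
    then obtain vs where inv: "round_inv E V t (alv s) (mem R s 0) vs" and stack: "stack s vs"
      and clean: "clean s" and len: "length vs \<le> card Z" and card: "card (alv s) \<le> card V - card Z"
      unfolding J_def by auto
    define p where "p = s\<lparr>reg := (reg s)(2 := Vtx i)\<rparr>"
    let ?A = "alv s"
    define q where "q = sem R pick p"
    define r where "r = sem R reduce q"
    have "?A \<subseteq> V" by (auto simp: alv_def)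
    have p: "mem R p d = mem R s d" "dct p = dct s" "reg p 8 = reg s 8" for d by (auto simp: p_def)
    have "finite Z" using Z(1) fin finite_subset by blast
    have Asub: "set (keys R) - mem R p 1 = ?A" by (simp only: p alv_def V_def)
    have red: "pruned E (alv q) (alv r)"
      "dct r 0 = (\<lambda>k. if k \<in> Vtx ` src E (alv q) then Num 1 else dct q 0 k)"
      "dct r 2 = dct q 2" "reg r 8 = reg q 8"
      using sem_reduce[OF dist, of q, folded r_def] unfolding E_def alv_def V_def by simp_all
    have pick: "dct q 0 = dct s 0"
      "mem R q 1 = mem R s 1 \<and> (?A = {} \<or> src E ?A \<noteq> {}) \<and> dct q 2 = dct s 2 \<and> reg q 8 = reg s 8 \<or>
      (\<exists>v\<in>?A. real (card (loss E ?A v)) \<le> t * real (card (gain E ?A v)) \<and>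
        alv q = rest E ?A v \<and> dct q 2 = (dct s 2)(reg s 8 := Vtx v) \<and> reg q 8 = val_inc (reg s 8))"
      using sem_pick[OF dist, of p t, folded q_def, unfolded Asub, folded E_def, OF ex[OF \<open>?A \<subseteq> V\<close>]]
      unfolding p alv_def V_def by simp_all
    have sub: "src E (alv q) \<subseteq> V" by (auto simp: src_def alv_def)
    have K: "mem R r 0 = mem R s 0 \<union> src E (alv q)" using sub by (auto simp: mem_def red pick V_def)
    have cl: "clean r" using clean sub by (auto simp: clean_def red pick)
    have finA: "finite ?A" using fin by (simp add: alv_def)
    \<comment> \<open>Progress: the sources disappear if there are any, otherwise the vertex put
      aside does.\<close>
    have "\<exists>vs'. round_inv E V t (alv r) (mem R r 0) vs' \<and> stack r vs' \<and>
      length vs' \<le> card (insert i Z) \<and> (alv r = {} \<or> alv r \<subset> ?A)"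
      using pick(2)
    proof
      assume a: "mem R q 1 = mem R s 1 \<and> (?A = {} \<or> src E ?A \<noteq> {}) \<and> dct q 2 = dct s 2 \<and> reg q 8 = reg s 8"
      then have q: "alv q = ?A" by (simp add: alv_def)
      have "round_inv E V t (alv r) (mem R r 0) vs"
        using round_inv_sources[OF inv fin t red(1)[unfolded q]] K q by simp
      moreover have "stack r vs" using a stack red(3,4) by (simp add: stack_def)
      moreover have "length vs \<le> card (insert i Z)" using len card_insert_le[of Z i] by linarith
      moreover have "alv r = {} \<or> alv r \<subset> ?A"
        using pruned_subset[OF red(1)] a unfolding q by (auto simp: src_def)
      ultimately show ?thesis by blast
    next
      assume "\<exists>v\<in>?A. real (card (loss E ?A v)) \<le> t * real (card (gain E ?A v)) \<and>
        alv q = rest E ?A v \<and> dct q 2 = (dct s 2)(reg s 8 := Vtx v) \<and> reg q 8 = val_inc (reg s 8)"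
      then obtain v where v: "v \<in> ?A" "real (card (loss E ?A v)) \<le> t * real (card (gain E ?A v))"
        and q: "alv q = rest E ?A v" "dct q 2 = (dct s 2)(reg s 8 := Vtx v)" "reg q 8 = val_inc (reg s 8)"
        by blast
      have "\<not> E v v" using v(1) irrefl by (auto simp: alv_def)
      then have "round_inv E V t (alv r) (mem R r 0) (vs @ [v])"
        using round_inv_vertex[OF inv fin t v(1) _ v(2) red(1)[unfolded q]] K q by simp
      moreover have "stack r (vs @ [v])"
        using stack red(3,4) q by (auto simp: stack_def nth_append less_Suc_eq)
      moreover have "length (vs @ [v]) \<le> card (insert i Z)" using len Z(3) \<open>finite Z\<close> by simp
      moreover have "alv r \<subset> ?A"
        using pruned_subset[OF red(1)] v(1) unfolding q by (auto simp: rest_def)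
      ultimately show ?thesis by blast
    qed
    then obtain vs' where vs': "round_inv E V t (alv r) (mem R r 0) vs'" "stack r vs'"
      "length vs' \<le> card (insert i Z)" "alv r = {} \<or> alv r \<subset> ?A" by blast
    have "card (alv r) \<le> card V - card (insert i Z)"
      using vs'(4)
    proof
      assume "alv r \<subset> ?A"
      then have "card (alv r) < card ?A" using finA psubset_card_mono by blast
      then show ?thesis using card Z \<open>finite Z\<close> by simp
    qed simp
    then have "J (insert i Z) r" using vs' cl unfolding J_def by blast
    then show "J (insert i Z) (sem R (Seq pick reduce) (s\<lparr>reg := (reg s)(2 := Vtx i)\<rparr>))"
      by (simp add: r_def q_def p_def)
  qed
  then obtain vs where inv: "round_inv E V t (alv s1) (mem R s1 0) vs" and stack: "stack s1 vs"
    and clean: "clean s1" and len: "length vs \<le> card V" and "card (alv s1) = 0"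
    unfolding J_def by auto
  then have "alv s1 = {}" using fin by (simp add: alv_def)
  \<comment> \<open>Nothing is left, so the invariant is applied with \<open>Q = {}\<close>.\<close>
  with inv have result: "qkernel E V (unwind E vs (mem R s1 0))"
    "(t + 1) * real (card (unwind E vs (mem R s1 0))) \<le> t * real (card V)"
    by (auto simp: round_inv_def qkernel_empty)
  \<comment> \<open>Absorbing the rest of the stack into the current dictionary 0 gives the final
    set; truncated subtraction forces \<open>j = 0\<close> at the end.\<close>
  define L where "L Z s \<longleftrightarrow> (\<exists>j \<le> length vs - card Z. reg s 8 = Num j \<and> dct s 2 = dct s1 2 \<and> clean s \<and>
      unwind E (take j vs) (mem R s 0) = unwind E vs (mem R s1 0))" for Z :: "'a set" and s
  define s2 where "s2 = sem R (For 2 Keys (Cond (Less (Const 0) (Reg 8)) pop Skip)) s1"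
  have "L V s2"
    unfolding s2_def
  proof (rule sem_For_keys[where Inv = L, OF dist, folded V_def])
    show "L {} s1" unfolding L_def using clean stack by (auto simp: stack_def)
    fix Z i and s :: "'a state" assume Z: "Z \<subseteq> V" "i \<in> V" "i \<notin> Z" and "L Z s"
    then obtain j where j: "j \<le> length vs - card Z" "reg s 8 = Num j" "dct s 2 = dct s1 2" "clean s"
      "unwind E (take j vs) (mem R s 0) = unwind E vs (mem R s1 0)" unfolding L_def by auto
    have "finite Z" using Z(1) fin finite_subset by blast
    then have card: "card (insert i Z) = Suc (card Z)" using Z(3) by simp
    let ?s = "s\<lparr>reg := (reg s)(2 := Vtx i)\<rparr>"
    show "L (insert i Z) (sem R (Cond (Less (Const 0) (Reg 8)) pop Skip) ?s)"
    proof (cases j)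
      case 0
      then have "sem R (Cond (Less (Const 0) (Reg 8)) pop Skip) ?s = ?s" using j by simp
      then show ?thesis using j 0 unfolding L_def by (auto simp: clean_def)
    next
      case (Suc j')
      let ?r = "sem R pop ?s"
      have r: "sem R (Cond (Less (Const 0) (Reg 8)) pop Skip) ?s = ?r" using j Suc by simp
      have less: "j' < length vs" using j(1) Suc by simp
      have v: "vs ! j' \<in> V" using inv less unfolding round_inv_def by (auto dest: nth_mem)
      have top: "dct ?s 2 (Num j') = Vtx (vs ! j')" "reg ?s 8 = Num (Suc j')"
        using j Suc stack less by (auto simp: stack_def)
      note pop = sem_pop[OF dist top(2,1) v[unfolded V_def], simplified, folded E_def V_def]
      have "unwind E (take j' vs) (mem R ?r 0) = unwind E (take j vs) (mem R s 0)"
        using less by (simp add: pop Suc take_Suc_conv_app_nth unwind_def)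
      then show ?thesis unfolding L_def r
        using j Suc card pop by (intro exI[of _ j']) (auto simp: clean_def)
    qed
  qed
  then have s2: "clean s2" "mem R s2 0 = unwind E vs (mem R s1 0)"
    using len unfolding L_def by (auto simp: unwind_def)
  have "Q = mem R s2 0"
    using s2(1) by (auto simp: Q_def small_quasi_kernel_def s1_def[symmetric] s2_def[symmetric]
        returned_def mem_def clean_def V_def simp del: sem.simps(5,7))
  then show "qkernel E V Q" "(t + 1) * real (card Q) \<le> t * real (card V)" using result s2(2) by auto
qed

section \<open>Digraphs\<close>

lemma dominates_induce_iff: "u \<rightarrow>\<^bsub>G \<restriction> A\<^esub> v \<longleftrightarrow> u \<in> A \<and> v \<in> A \<and> u \<rightarrow>\<^bsub>G\<^esub> v"
  by (auto simp: arcs_ends_conv image_iff)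

text \<open>In-degree is a cardinality, which would be 0 for infinitely many arcs as well; hence the
  finiteness assumption.\<close>

lemma sources_conv:
  assumes "finite (arcs G)"
  shows "sources G = {v \<in> verts G. \<forall>u. \<not> u \<rightarrow>\<^bsub>G\<^esub> v}"
proof -
  have "finite (in_arcs G v)" for v using assms by (auto simp: in_arcs_def)
  then show ?thesis by (auto simp: sources_def in_degree_def in_arcs_def arcs_ends_conv image_iff)
qed

text \<open>A walk with at most two arcs bounds the unit-cost distance. \<open>E\<close> is compared
  with the arcs only at targets in \<open>verts G\<close>, as \<open>stores\<close> fixes in-sets
  only for vertices.\<close>

lemma quasi_kernelI:
  assumes "digraph G" and E: "\<And>u v. v \<in> verts G \<Longrightarrow> E u v \<longleftrightarrow> u \<rightarrow>\<^bsub>G\<^esub> v"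
    and Q: "qkernel E (verts G) Q"
  shows "quasi_kernel G Q"
proof -
  interpret digraph G by fact
  have sub: "Q \<subseteq> verts G" using Q unfolding qkernel_def by auto
  have "\<exists>v\<in>Q. vdist G v u \<le> 2" if u: "u \<in> verts G" for u
  proof -
    have le: "vdist G v u \<le> 2" if "awalk v p u" "length p \<le> 2" for v p
    proof -
      have "awalk_cost (\<lambda>_. 1) p = real (length p)" by (induction p) auto
      then have "\<mu> (\<lambda>_. 1) v u \<le> ereal (real (length p))"
        using min_cost_le_walk_cost[OF that(1), of "\<lambda>_. 1"] by simp
      also have "\<dots> \<le> ereal 2" using that(2) by simp
      finally show ?thesis by (simp add: vdist_def)
    qed
    consider "u \<in> Q" | "u \<in> nbrs E (verts G) Q" | "u \<in> nbrs E (verts G) (nbrs E (verts G) Q)"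
      using u Q unfolding qkernel_def by blast
    then show ?thesis
    proof cases
      case 1
      then show ?thesis using le[of u "[]"] u by (auto simp: awalk_Nil_iff)
    next
      case 2
      then obtain q where q: "q \<in> Q" "q \<rightarrow>\<^bsub>G\<^esub> u" using E by (auto simp: nbrs_def)
      then obtain e where "e \<in> arcs G" "tail G e = q" "head G e = u" by (auto simp: arcs_ends_conv)
      then have "awalk q [e] u" by (auto simp: awalk_Cons_iff awalk_Nil_iff)
      then show ?thesis using le[of q "[e]"] q(1) by auto
    next
      case 3
      then obtain w q where q: "q \<in> Q" "q \<rightarrow>\<^bsub>G\<^esub> w" "w \<rightarrow>\<^bsub>G\<^esub> u" using E by (auto simp: nbrs_def)
      then obtain e f where "e \<in> arcs G" "tail G e = q" "head G e = w"
        "f \<in> arcs G" "tail G f = w" "head G f = u" by (auto simp: arcs_ends_conv)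
      then have "awalk q [e, f] u" by (auto simp: awalk_Cons_iff awalk_Nil_iff)
      then show ?thesis using le[of q "[e, f]"] q(1) by auto
    qed
  qed
  moreover have "independent_set G Q"
    using Q sub E unfolding qkernel_def independent_set_def by blast
  ultimately show ?thesis unfolding quasi_kernel_def by blast
qed

lemma src_eq_sources:
  assumes "digraph G" "A \<subseteq> verts G" and E: "\<And>u v. v \<in> verts G \<Longrightarrow> E u v \<longleftrightarrow> u \<rightarrow>\<^bsub>G\<^esub> v"
  shows "src E A = sources (G \<restriction> A)"
proof -
  interpret digraph G by fact
  show ?thesis
    using assms(2) E by (subst sources_conv) (auto simp: src_def dominates_induce_iff)
qed

lemma exists_good_vertex:
  fixes t :: real
  assumes G: "digraph G" and A: "A \<subseteq> verts G"
    and E: "\<And>u v. v \<in> verts G \<Longrightarrow> E u v \<longleftrightarrow> u \<rightarrow>\<^bsub>G\<^esub> v"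
    and ex: "\<exists>v\<in>verts (G \<restriction> A).
        (v \<notin> out_nbrs_of_set (G \<restriction> A) (residual_sources (G \<restriction> A) v) \<and>
          t * real (card (out_nbrs (G \<restriction> A) v \<union> out_nbrs_of_set (G \<restriction> A) (residual_sources (G \<restriction> A) v)))
            \<ge> real (card (residual_sources (G \<restriction> A) v)) + 1) \<or>
        (v \<in> out_nbrs_of_set (G \<restriction> A) (residual_sources (G \<restriction> A) v) \<and>
          t * real (card (out_nbrs (G \<restriction> A) v \<union> out_nbrs_of_set (G \<restriction> A) (residual_sources (G \<restriction> A) v)))
            \<ge> real (card (residual_sources (G \<restriction> A) v)))"
  shows "\<exists>v\<in>A. real (card (loss E A v)) \<le> t * real (card (gain E A v))"
proof -
  interpret digraph G by fact
  let ?D = "G \<restriction> A"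
  have fin: "finite A" using A finite_subset finite_verts by blast
  have out: "out_nbrs ?D v = nbrs E A {v}" if "v \<in> A" for v
    using that A E by (auto simp: out_nbrs_def nbrs_def dominates_induce_iff)
  have out_set: "out_nbrs_of_set ?D S = nbrs E A S" if "S \<subseteq> A" for S
    using that out by (auto simp: out_nbrs_of_set_def nbrs_def)
  have res: "residual_sources ?D v = src E (rest E A v)" if "v \<in> A" for v
  proof -
    have "verts ?D - closed_out_nbrs ?D v = rest E A v"
      using that by (auto simp: closed_out_nbrs_def out nbrs_def rest_def)
    then have "residual_sources ?D v = sources (?D \<restriction> rest E A v)" by (simp add: residual_sources_def)
    also have "\<dots> = src E (rest E A v)"
      using A E by (subst sources_conv) (auto simp: src_def rest_def dominates_induce_iff)
    finally show ?thesis .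
  qed
  have sub: "src E (rest E A v) \<subseteq> A" "v \<notin> src E (rest E A v)" for v by (auto simp: src_def rest_def)
  \<comment> \<open>The \<open>+ 1\<close> of the first alternative is \<open>v\<close>
    itself.\<close>
  have card_loss: "card (loss E A v) = (if v \<in> nbrs E A (src E (rest E A v))
      then card (src E (rest E A v)) else card (src E (rest E A v)) + 1)" if "v \<in> A" for v
    using that sub[of v] finite_subset[OF sub(1) fin] by (auto simp: loss_def absorb_def nbrs_def)
  obtain v where "v \<in> A" and "(v \<notin> nbrs E A (src E (rest E A v)) \<and>
      t * real (card (gain E A v)) \<ge> real (card (src E (rest E A v))) + 1) \<or>
      (v \<in> nbrs E A (src E (rest E A v)) \<and>
      t * real (card (gain E A v)) \<ge> real (card (src E (rest E A v))))"
    using ex by (auto simp: res out out_set[OF sub(1)] gain_def)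
  then show ?thesis using card_loss[of v] by (intro bexI[of _ v]) auto
qed

text \<open>Lets the existence of a small quasi-kernel be read off from a run of the
  program.\<close>

lemma stores_exists:
  assumes "digraph G" shows "\<exists>R. stores R G"
proof -
  interpret digraph G by fact
  obtain ks where ks: "set ks = verts G" "distinct ks" using finite_distinct_list[OF finite_verts] by blast
  have "in_nbrs G v \<subseteq> verts G" "out_nbrs G v \<subseteq> verts G" for v
    by (auto simp: in_nbrs_def out_nbrs_def arcs_ends_conv)
  then have "\<forall>v. \<exists>xs. set xs = in_nbrs G v \<and> distinct xs" "\<forall>v. \<exists>xs. set xs = out_nbrs G v \<and> distinct xs"
    using finite_distinct_list finite_subset[OF _ finite_verts] by metis+
  then obtain f g where "\<And>v. set (f v) = in_nbrs G v \<and> distinct (f v)" "\<And>v. set (g v) = out_nbrs G v \<and> distinct (g v)"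
    by metis
  then have "stores \<lparr>keys = ks, in_set = f, out_set = g\<rparr> G" using ks by (simp add: stores_def)
  then show ?thesis by blast
qed

theorem theorem1p2:
  fixes t :: real and \<H> :: "('a, 'b) pre_digraph set"
  assumes "t \<ge> 1"
    and "\<And>D. D \<in> \<H> \<Longrightarrow> digraph D"
    and "hereditary \<H>"
    and "\<And>D. \<lbrakk>D \<in> \<H>; verts D \<noteq> {}; sourceless D\<rbrakk> \<Longrightarrow>
      \<exists>v\<in>verts D.
        (v \<notin> out_nbrs_of_set D (residual_sources D v) \<and>
          t * real (card (out_nbrs D v \<union> out_nbrs_of_set D (residual_sources D v)))
            \<ge> real (card (residual_sources D v)) + 1) \<or>
        (v \<in> out_nbrs_of_set D (residual_sources D v) \<and>
          t * real (card (out_nbrs D v \<union> out_nbrs_of_set D (residual_sources D v)))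
            \<ge> real (card (residual_sources D v)))"
  shows "(\<exists>(p :: com) (T :: nat \<Rightarrow> nat).
            (\<lambda>n. real (T n)) \<in> O(\<lambda>n. real n ^ 4) \<and>
            (\<forall>D\<in>\<H>. \<forall>R. sourceless D \<longrightarrow> stores R D \<longrightarrow>
              (\<exists>k s. exec R p init_state k s \<and> k \<le> T (card (verts D)) \<and>
                 quasi_kernel D (returned s) \<and>
                 real (card (returned s)) \<le> t * real (card (verts D)) / (t + 1)))) \<and>
         (\<forall>D\<in>\<H>. sourceless D \<longrightarrow>
            (\<exists>Q. quasi_kernel D Q \<and> real (card Q) \<le> t * real (card (verts D)) / (t + 1)))"
proof -
  let ?p = small_quasi_kernel
  let ?T = "\<lambda>n. cost n ?p"
  have divide: "c \<le> d / (t + 1)" if "(t + 1) * c \<le> d" for c d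
    using that assms(1) by (subst pos_le_divide_eq) (auto simp: mult.commute)
  have run: "\<exists>k s. exec R ?p init_state k s \<and> k \<le> ?T (card (verts D)) \<and> quasi_kernel D (returned s) \<and>
      real (card (returned s)) \<le> t * real (card (verts D)) / (t + 1)"
    if D: "D \<in> \<H>" "sourceless D" "stores R D" for D R
  proof -
    have dg: "digraph D" using assms(2) D(1) .
    interpret digraph D by fact
    have dist: "distinct (keys R)" and V: "set (keys R) = verts D" using D(3) by (auto simp: stores_def)
    have E: "edge R u v \<longleftrightarrow> u \<rightarrow>\<^bsub>D\<^esub> v" if "v \<in> verts D" for u v
      using that D(3) by (simp add: stores_def edge_def in_nbrs_def)
    have irrefl: "\<not> edge R v v" if "v \<in> set (keys R)" for v
      using that V E[of v v] adj_not_same[of v] by auto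
    \<comment> \<open>Viewing \<open>D\<close> as its own induced subdigraph makes
      \<open>src_eq_sources\<close> applicable.\<close>
    have "D \<restriction> verts D = D" by (rule pre_digraph.equality) auto
    then have no_src: "src (edge R) (set (keys R)) = {}"
      using src_eq_sources[OF dg subset_refl E] D(2) V by (simp add: sourceless_def)
    have good: "\<exists>v\<in>A. real (card (loss (edge R) A v)) \<le> t * real (card (gain (edge R) A v))"
      if "A \<subseteq> set (keys R)" "A \<noteq> {}" "src (edge R) A = {}" for A
    proof (rule exists_good_vertex[OF dg _ E])
      show A: "A \<subseteq> verts D" using that(1) V by simp
      show "\<exists>v\<in>verts (D \<restriction> A).
        (v \<notin> out_nbrs_of_set (D \<restriction> A) (residual_sources (D \<restriction> A) v) \<and>
          t * real (card (out_nbrs (D \<restriction> A) v \<union> out_nbrs_of_set (D \<restriction> A) (residual_sources (D \<restriction> A) v)))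
            \<ge> real (card (residual_sources (D \<restriction> A) v)) + 1) \<or>
        (v \<in> out_nbrs_of_set (D \<restriction> A) (residual_sources (D \<restriction> A) v) \<and>
          t * real (card (out_nbrs (D \<restriction> A) v \<union> out_nbrs_of_set (D \<restriction> A) (residual_sources (D \<restriction> A) v)))
            \<ge> real (card (residual_sources (D \<restriction> A) v)))"
      proof (rule assms(4))
        show "D \<restriction> A \<in> \<H>" using assms(3) D(1) induced_induce[OF A] by (auto simp: hereditary_def)
        show "verts (D \<restriction> A) \<noteq> {}" using that(2) by simp
        show "sourceless (D \<restriction> A)" using src_eq_sources[OF dg A E] that(3) by (simp add: sourceless_def)
      qed
    qed
    note result = sem_small_quasi_kernel[OF dist assms(1) irrefl no_src good, unfolded V]
    let ?s = "sem R ?p init_state"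
    obtain k where "exec R ?p init_state k ?s" "k \<le> ?T (length (keys R))"
      using exec_sem[OF small_quasi_kernel_loops(1)] by blast
    moreover have "length (keys R) = card (verts D)" using dist V distinct_card by metis
    moreover have "quasi_kernel D (returned ?s)" using quasi_kernelI[OF dg E result(1)] .
    moreover have "real (card (returned ?s)) \<le> t * real (card (verts D)) / (t + 1)"
      using divide[OF result(2)] .
    ultimately show ?thesis by metis
  qed
  obtain C where C: "\<And>n. ?T n \<le> C * (n + 1) ^ 4"
    using cost_le_power[of ?p] small_quasi_kernel_loops(2) by auto
  have "(\<lambda>n. real (?T n)) \<in> O(\<lambda>n. real n ^ 4)"
  proof (rule bigoI[of _ "16 * real C"], rule eventually_at_top_linorderI[of 1])
    fix n :: nat assume "1 \<le> n"
    \<comment> \<open>From \<open>n + 1 \<le> 2 * n\<close> the constant \<open>16 = 2 ^ 4\<close>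
      arises.\<close>
    then have "C * (n + 1) ^ 4 \<le> C * (2 * n) ^ 4" by (intro mult_left_mono power_mono) auto
    then have "?T n \<le> C * (2 * n) ^ 4" using le_trans[OF C] by blast
    then have "real (?T n) \<le> real (C * (2 * n) ^ 4)" by (rule of_nat_mono)
    then show "norm (real (?T n)) \<le> 16 * real C * norm (real n ^ 4)"
      by (simp add: power_mult_distrib)
  qed
  moreover have "\<exists>Q. quasi_kernel D Q \<and> real (card Q) \<le> t * real (card (verts D)) / (t + 1)"
    if "D \<in> \<H>" "sourceless D" for D
    using run[OF that] stores_exists[OF assms(2)[OF that(1)]] by blast
  ultimately show ?thesis
    using run by (intro conjI exI[of _ ?p] exI[of _ ?T] ballI allI impI) assumption+
qed

end
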